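(* Let $\mathcal{G}$ be a finite abelian group of order $G$ and let $\mathcal{D}$ be a nonempty composite difference set for $\mathcal{G}$ with $D=\#(\mathcal{D})$. Let $S=\left[\frac{D(G-1)}{G-D}\right]^{1/2}$, and let $\mathcal{H}$ (a subgroup of $\mathcal{G}$ of order $H$ for which $\mathcal{D}$ is $\mathcal{H}$-fine), $\mathcal{A}$ (an $S$-element subset of $\mathcal{G}$) and $\mathcal{B}$ (a difference set for $\mathcal{H}$) be as in the definition of composite, so that $\chi_{\mathcal{D}}=\chi_{\mathcal{A}}*\chi_{\mathcal{B}}$. For any $\gamma\in\hat{\mathcal{G}}$, let $\boldsymbol{\zeta}_\gamma\in\mathbb{C}^{\mathcal{B}}$, $\boldsymbol{\zeta}_\gamma(b):=\frac{\sqrt{S}}{\sqrt{D}}\gamma(b)$. Then: (a) $\mathcal{B}$ has cardinality $\frac{D}{S}$, and $\mathcal{A}$ is an $\mathcal{H}$-$\mathrm{RDS}(S+1,H,S,\frac{S-1}{H})$ that is disjoint from $\mathcal{H}$. Moreover, $G-D$ divides $D-1$. (b) $\mathcal{D}$ is an amalgam, with $\mathcal{D}_a=\mathcal{H}\cap(\mathcal{D}-a)=\mathcal{B}$ for every $a\in\mathcal{A}$. (c) The orthogonal projection operators $\{\mathbf{P}_{\overline{\gamma}}\}_{\overline{\gamma}\in\hat{\mathcal{G}}/\mathcal{H}^\perp}$ onto the subspaces $$\mathcal{U}_{\overline{\gamma}}:=\operatorname{span}\{\boldsymbol{\varphi}_{\gamma\gamma'}\}_{\gamma'\in\mathcal{H}^\perp}\subseteq\mathbb{C}^{\mathcal{D}},\qquad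 \boldsymbol{\varphi}_\gamma(d):=\tfrac{1}{\sqrt{D}}\gamma(d),$$ satisfy $$\langle\boldsymbol{\zeta}_{\gamma_1},\boldsymbol{\zeta}_{\gamma_3}\rangle\,\mathbf{P}_{\overline{\gamma}_1}\mathbf{P}_{\overline{\gamma}_2}\mathbf{P}_{\overline{\gamma}_3}=\langle\boldsymbol{\zeta}_{\gamma_1},\boldsymbol{\zeta}_{\gamma_2}\rangle\langle\boldsymbol{\zeta}_{\gamma_2},\boldsymbol{\zeta}_{\gamma_3}\rangle\,\mathbf{P}_{\overline{\gamma}_1}\mathbf{P}_{\overline{\gamma}_3},\qquad\forall\ \gamma_1,\gamma_2,\gamma_3\in\hat{\mathcal{G}},$$ where $|\langle\boldsymbol{\zeta}_\gamma,\boldsymbol{\zeta}_{\gamma'}\rangle|=1$ if $\overline{\gamma}=\overline{\gamma}'$ and $|\langle\boldsymbol{\zeta}_\gamma,\boldsymbol{\zeta}_{\gamma'}\rangle|=\frac{1}{\sqrt{S}}$ if $\overline{\gamma}\neq\overline{\gamma}'$.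
   Context: Groups $\mathcal{G}$ are written additively. A subset $\mathcal{D}$ of a finite abelian group $\mathcal{G}$ is a difference set for $\mathcal{G}$ if every nonzero $g\in\mathcal{G}$ can be written as $g=d-d'$ with $(d,d')\in\mathcal{D}\times\mathcal{D}$ in the same number of ways (the empty set is trivially a difference set). For a subgroup $\mathcal{H}$ of order $H$ of an abelian group $\mathcal{G}$ of order $G$, a subset $\mathcal{A}$ of $\mathcal{G}$ is an $\mathcal{H}$-relative difference set ($\mathcal{H}$-RDS) if no nonzero member of $\mathcal{H}$ is a difference of two members of $\mathcal{A}$, while every $g\notin\mathcal{H}$ can be written as a difference $a-a'$ of members of $\mathcal{A}$ in the same number $\Lambda$ of ways; such a set with $k$ elements is denoted an $\mathcal{H}$-$\mathrm{RDS}(\frac{G}{H},H,k,\Lambda)$. A nonempty $D$-element difference set $\mathcal{D}$ for an abelian group $\mathcal{G}$ of order $G$ is $\mathcal{H}$-fine, for a subgroup $\mathcal{H}$, if $\mathcal{D}\cap\mathcal{H}=\emptyset$ and $\mathcal{H}$ has order $H=\frac{G}{S+1}$, where $S=\left[\frac{D(G-1)}{G-D}\right]^{1/2}$. (For such $\mathcal{D}$, $S$ is an integer.) $\mathcal{D}$ is an amalgam if it is $\mathcal{H}$-fine for some subgroup $\mathcal{H}$ of $\mathcal{G}$ and, for every $g\in\mathcal{G}$, $\mathcal{D}_g:=\mathcal{H}\cap(\mathcal{D}-g)$ is a difference set for $\mathcal{H}$. $\mathcal{D}$ is composite if it is $\mathcal{H}$-fine for some subgroup $\mathcal{H}$ of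 $\mathcal{G}$ and moreover there exist an $S$-element subset $\mathcal{A}$ of $\mathcal{G}$ and a difference set $\mathcal{B}$ for $\mathcal{H}$ such that $\chi_{\mathcal{D}}=\chi_{\mathcal{A}}*\chi_{\mathcal{B}}$. Here $\chi_{\mathcal{X}}:\mathcal{G}\to\mathbb{C}$ is the characteristic function of $\mathcal{X}\subseteq\mathcal{G}$ and $(\mathbf{x}_1*\mathbf{x}_2)(g)=\sum_{g'\in\mathcal{G}}\mathbf{x}_1(g')\mathbf{x}_2(g-g')$. $\hat{\mathcal{G}}$ is the multiplicative group of characters $\gamma:\mathcal{G}\to\{z\in\mathbb{C}:|z|=1\}$, $\mathcal{H}^\perp=\{\gamma\in\hat{\mathcal{G}}:\gamma(h)=1\ \forall h\in\mathcal{H}\}$, and $\overline{\gamma}=\gamma\mathcal{H}^\perp$. Inner products are conjugate-linear in the first argument: $\langle\mathbf{y}_1,\mathbf{y}_2\rangle=\sum_n\overline{\mathbf{y}_1(n)}\,\mathbf{y}_2(n)$. *)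

theory Defs
  imports
    Complex_Main
    "HOL-Library.Cardinality"
    "HOL-Library.Indicator_Function"
    "HOL-Library.Function_Algebras"
begin

(* A finite abelian group is a type of class {finite, ab_group_add}; its subgroups are sets. *)

definition is_subgroup :: "'g::ab_group_add set \<Rightarrow> bool" where
  "is_subgroup H \<longleftrightarrow> 0 \<in> H \<and> (\<forall>x\<in>H. \<forall>y\<in>H. x + y \<in> H) \<and> (\<forall>x\<in>H. - x \<in> H)"

definition diff_count :: "'g::ab_group_add set \<Rightarrow> 'g \<Rightarrow> nat" where
  "diff_count X g = card {(d, d'). d \<in> X \<and> d' \<in> X \<and> g = d - d'}"

(* The first argument is the group: UNIV for the whole group, or a subgroup. *)
definition difference_set :: "'g::ab_group_add set \<Rightarrow> 'g set \<Rightarrow> bool" where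
  "difference_set K X \<longleftrightarrow> X \<subseteq> K \<and> (\<exists>\<Lambda>. \<forall>g\<in>K - {0}. diff_count X g = \<Lambda>)"

(* relative_difference_set H A n h k \<Lambda>: A is an H-RDS(n, h, k, \<Lambda>). The parameters are reals
   because they are given by quotients and square roots. *)
definition relative_difference_set ::
  "'g::{finite,ab_group_add} set \<Rightarrow> 'g set \<Rightarrow> real \<Rightarrow> real \<Rightarrow> real \<Rightarrow> real \<Rightarrow> bool" where
  "relative_difference_set H A n h k \<Lambda> \<longleftrightarrow>
     is_subgroup H \<and>
     (\<forall>g\<in>H - {0}. \<not> (\<exists>a\<in>A. \<exists>a'\<in>A. g = a - a')) \<and>
     (\<forall>g. g \<notin> H \<longrightarrow> real (diff_count A g) = \<Lambda>) \<and>
     n = real CARD('g) / real (card H) \<and> h = real (card H) \<and> k = real (card A)"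

definition fine_S :: "'g::{finite,ab_group_add} set \<Rightarrow> real" where
  "fine_S D = sqrt (real (card D) * (real CARD('g) - 1) / (real CARD('g) - real (card D)))"

definition fine :: "'g::{finite,ab_group_add} set \<Rightarrow> 'g set \<Rightarrow> bool" where
  "fine H D \<longleftrightarrow> difference_set UNIV D \<and> D \<noteq> {} \<and> is_subgroup H \<and> D \<inter> H = {} \<and>
     real (card H) = real CARD('g) / (fine_S D + 1)"

definition slice :: "'g::ab_group_add set \<Rightarrow> 'g set \<Rightarrow> 'g \<Rightarrow> 'g set" where
  "slice H D g = H \<inter> (\<lambda>d. d - g) ` D"

definition amalgam_via :: "'g::{finite,ab_group_add} set \<Rightarrow> 'g set \<Rightarrow> bool" where
  "amalgam_via H D \<longleftrightarrow> fine H D \<and> (\<forall>g. difference_set H (slice H D g))"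

definition amalgam :: "'g::{finite,ab_group_add} set \<Rightarrow> bool" where
  "amalgam D \<longleftrightarrow> (\<exists>H. amalgam_via H D)"

definition convolution ::
  "('g::{finite,ab_group_add} \<Rightarrow> complex) \<Rightarrow> ('g \<Rightarrow> complex) \<Rightarrow> 'g \<Rightarrow> complex" where
  "convolution x y g = (\<Sum>g'\<in>UNIV. x g' * y (g - g'))"

definition composite_via ::
  "'g::{finite,ab_group_add} set \<Rightarrow> 'g set \<Rightarrow> 'g set \<Rightarrow> 'g set \<Rightarrow> bool" where
  "composite_via H A B D \<longleftrightarrow> fine H D \<and> real (card A) = fine_S D \<and> difference_set H B \<and>
     indicator D = convolution (indicator A) (indicator B)"

definition composite :: "'g::{finite,ab_group_add} set \<Rightarrow> bool" where
  "composite D \<longleftrightarrow> (\<exists>H A B. composite_via H A B D)"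

definition characters :: "('g::ab_group_add \<Rightarrow> complex) set" where
  "characters = {\<gamma>. (\<forall>x. cmod (\<gamma> x) = 1) \<and> (\<forall>x y. \<gamma> (x + y) = \<gamma> x * \<gamma> y)}"

definition annihilator :: "'g::ab_group_add set \<Rightarrow> ('g \<Rightarrow> complex) set" where
  "annihilator H = {\<gamma> \<in> characters. \<forall>h\<in>H. \<gamma> h = 1}"

(* The product of characters is the pointwise one of HOL-Library.Function_Algebras. *)
definition char_coset :: "'g::ab_group_add set \<Rightarrow> ('g \<Rightarrow> complex) \<Rightarrow> ('g \<Rightarrow> complex) set" where
  "char_coset H \<gamma> = (\<lambda>\<gamma>'. \<gamma> * \<gamma>') ` annihilator H"

(* For a subset N of the group, the space of complex vectors indexed by N is represented by the
   functions on the group that vanish outside N. *)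
definition cvec :: "'g set \<Rightarrow> ('g \<Rightarrow> complex) set" where
  "cvec N = {x. \<forall>g. g \<notin> N \<longrightarrow> x g = 0}"

definition cinner :: "'g set \<Rightarrow> ('g \<Rightarrow> complex) \<Rightarrow> ('g \<Rightarrow> complex) \<Rightarrow> complex" where
  "cinner N x y = (\<Sum>n\<in>N. cnj (x n) * y n)"

definition cscale :: "complex \<Rightarrow> ('g \<Rightarrow> complex) \<Rightarrow> 'g \<Rightarrow> complex" where
  "cscale c x = (\<lambda>g. c * x g)"

global_interpretation cfun: vector_space "cscale :: complex \<Rightarrow> ('g \<Rightarrow> complex) \<Rightarrow> 'g \<Rightarrow> complex"
  by unfold_locales (auto simp: cscale_def fun_eq_iff algebra_simps)

definition orth_proj ::
  "'g set \<Rightarrow> ('g \<Rightarrow> complex) set \<Rightarrow> ('g \<Rightarrow> complex) \<Rightarrow> 'g \<Rightarrow> complex" where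
  "orth_proj N U x = (THE y. y \<in> U \<and> (\<forall>u\<in>U. cinner N u (x - y) = 0))"

definition phi :: "'g::ab_group_add set \<Rightarrow> ('g \<Rightarrow> complex) \<Rightarrow> 'g \<Rightarrow> complex" where
  "phi D \<gamma> = (\<lambda>d. if d \<in> D then complex_of_real (1 / sqrt (real (card D))) * \<gamma> d else 0)"

definition zeta ::
  "'g::{finite,ab_group_add} set \<Rightarrow> 'g set \<Rightarrow> ('g \<Rightarrow> complex) \<Rightarrow> 'g \<Rightarrow> complex" where
  "zeta D B \<gamma> = (\<lambda>b. if b \<in> B
     then complex_of_real (sqrt (fine_S D) / sqrt (real (card D))) * \<gamma> b else 0)"

(* coset_space and coset_proj take a coset of the annihilator, i.e. a set of characters. *)
definition coset_space ::
  "'g::ab_group_add set \<Rightarrow> ('g \<Rightarrow> complex) set \<Rightarrow> ('g \<Rightarrow> complex) set" where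
  "coset_space D c = cfun.span (phi D ` c)"

definition coset_proj ::
  "'g::ab_group_add set \<Rightarrow> ('g \<Rightarrow> complex) set \<Rightarrow> ('g \<Rightarrow> complex) \<Rightarrow> 'g \<Rightarrow> complex" where
  "coset_proj D c = orth_proj D (coset_space D c)"

end

theory Submission
  imports Defs
begin

text \<open>The sums \<open>a + b\<close> represent every element of \<open>D\<close> once, so \<open>#D = S #B\<close>. Counting the pairs of
  \<open>D\<close> with difference in \<open>H\<close> in two ways shows that \<open>A\<close> has exactly one element in each nontrivial
  coset of \<open>H\<close>. Expanding the difference counts of \<open>D\<close> in those of \<open>B\<close> then determines the
  difference counts of \<open>A\<close>, and the slices of \<open>D\<close> are empty or translates of \<open>B\<close>.
  For the projections, the characters that are trivial on \<open>H\<close> span the functions on the cosets of \<open>H\<close>,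
  so the subspace of \<open>\<gamma>\<close> consists of the vectors that are multiples of \<open>\<gamma>\<close> on every block
  \<open>a + B\<close>. The projections therefore act blockwise with rank one, and on each block they satisfy the triple
  product identity.\<close>

section \<open>Counting differences\<close>

lemma is_subgroup_diff: "is_subgroup H \<Longrightarrow> x \<in> H \<Longrightarrow> y \<in> H \<Longrightarrow> x - y \<in> H"
  unfolding is_subgroup_def by (metis diff_conv_add_uminus)

lemma is_subgroup_diff_swap: "is_subgroup H \<Longrightarrow> x - y \<in> H \<Longrightarrow> y - x \<in> H"
  unfolding is_subgroup_def by (metis minus_diff_eq)

lemma is_subgroup_diff_trans:
  "is_subgroup H \<Longrightarrow> x - y \<in> H \<Longrightarrow> y - z \<in> H \<Longrightarrow> x - z \<in> H"
  unfolding is_subgroup_def by (metis diff_add_cancel add_diff_eq)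

lemma sum_of_bool_card:
  "finite X \<Longrightarrow> (\<Sum>x\<in>X. of_bool (P x)) = (of_nat (card {x \<in> X. P x}) :: 'a::semiring_1)"
  by (simp add: Int_def)

lemma diff_count_conv_sum:
  fixes X :: "'g::{finite,ab_group_add} set"
  shows "diff_count X g = (\<Sum>x\<in>X. \<Sum>y\<in>X. of_bool (x - y = g))"
proof -
  have "diff_count X g = card {p \<in> X \<times> X. fst p - snd p = g}"
    unfolding diff_count_def by (rule arg_cong[where f = card]) auto
  also have "\<dots> = (\<Sum>p\<in>X \<times> X. of_bool (fst p - snd p = g))"
    by (simp only: sum_of_bool_card finite of_nat_id)
  also have "\<dots> = (\<Sum>x\<in>X. \<Sum>y\<in>X. of_bool (x - y = g))"
    by (simp only: sum.cartesian_product split_def)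
  finally show ?thesis .
qed

text \<open>Pairs are grouped by their difference. A constant \<open>f\<close> counts the pairs, and
  a character for \<open>f\<close> gives the squared modulus of a character sum.\<close>

lemma sum_diff_count:
  fixes X :: "'g::{finite,ab_group_add} set" and f :: "'g \<Rightarrow> 'b::comm_semiring_1"
  shows "(\<Sum>g\<in>UNIV. of_nat (diff_count X g) * f g) = (\<Sum>x\<in>X. \<Sum>y\<in>X. f (x - y))"
proof -
  have "(\<Sum>g\<in>UNIV. of_nat (diff_count X g) * f g)
      = (\<Sum>g\<in>UNIV. \<Sum>x\<in>X. \<Sum>y\<in>X. of_bool (x - y = g) * f g)"
    by (simp add: diff_count_conv_sum sum_distrib_right)
  also have "\<dots> = (\<Sum>x\<in>X. \<Sum>g\<in>UNIV. \<Sum>y\<in>X. of_bool (x - y = g) * f g)"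
    by (rule sum.swap)
  also have "\<dots> = (\<Sum>x\<in>X. \<Sum>y\<in>X. \<Sum>g\<in>UNIV. of_bool (x - y = g) * f g)"
    by (rule sum.cong[OF refl], rule sum.swap)
  also have "\<dots> = (\<Sum>x\<in>X. \<Sum>y\<in>X. f (x - y))"
    by (intro sum.cong refl) (simp add: of_bool_def if_distrib[of "\<lambda>c. c * _"] cong: if_cong)
  finally show ?thesis .
qed

lemma diff_count_0:
  fixes X :: "'g::{finite,ab_group_add} set"
  shows "diff_count X 0 = card X"
  by (simp add: diff_count_conv_sum of_bool_def)

lemma diff_count_outside:
  assumes "is_subgroup H" "X \<subseteq> H" "g \<notin> H"
  shows "diff_count X g = 0"
proof -
  have "{(d, d'). d \<in> X \<and> d' \<in> X \<and> g = d - d'} = {}"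
    using assms is_subgroup_diff[OF assms(1)] by auto
  then show ?thesis unfolding diff_count_def by (simp only: card.empty)
qed

lemma diff_count_translate:
  fixes X :: "'g::{finite,ab_group_add} set"
  shows "diff_count ((+) t ` X) g = diff_count X g"
  by (simp add: diff_count_conv_sum sum.reindex del: sum_of_bool_eq)

lemma sum_diff_count_univ:
  fixes X :: "'g::{finite,ab_group_add} set"
  shows "(\<Sum>g\<in>UNIV. diff_count X g) = (card X)\<^sup>2"
  using sum_diff_count[of X "\<lambda>_. 1 :: nat"] by (simp add: power2_eq_square)

text \<open>Of the \<open>(card X)\<^sup>2\<close> ordered pairs, the diagonal accounts for
  \<open>card X\<close> and each nonzero element of \<open>K\<close> for \<open>l\<close>. If
  \<open>K\<close> is trivial, nothing fixes \<open>l\<close>; the choice 0 then keeps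
  \<open>card X - l\<close> positive for nonempty \<open>X\<close>.\<close>

lemma difference_set_index:
  fixes X K :: "'g::{finite,ab_group_add} set"
  assumes "is_subgroup K" "difference_set K X"
  obtains l where "\<And>g. g \<in> K - {0} \<Longrightarrow> diff_count X g = l"
    "real (card X) * (real (card X) - 1) = real l * (real (card K) - 1)"
    "card K = 1 \<Longrightarrow> l = 0"
proof -
  note goal = that
  have 0: "0 \<in> K" and XK: "X \<subseteq> K"
    using assms by (auto simp: is_subgroup_def difference_set_def)
  have *: thesis if l: "\<And>g. g \<in> K - {0} \<Longrightarrow> diff_count X g = l" and "card K = 1 \<Longrightarrow> l = 0" for l
  proof (rule goal[of l])
    have "(card X)\<^sup>2 = (\<Sum>g\<in>UNIV. diff_count X g)" by (simp only: sum_diff_count_univ)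
    also have "\<dots> = (\<Sum>g\<in>K. diff_count X g)"
      by (rule sum.mono_neutral_right) (auto simp: diff_count_outside[OF assms(1) XK])
    also have "\<dots> = card X + (\<Sum>g\<in>K - {0}. diff_count X g)"
      using 0 by (simp add: sum.remove[of K 0] diff_count_0)
    also have "\<dots> = card X + l * (card K - 1)"
      using 0 l by (simp add: mult.commute)
    finally have "real ((card X)\<^sup>2) = real (card X) + real l * real (card K - 1)"
      by (simp only: of_nat_add of_nat_mult)
    moreover have "card K \<ge> 1" using 0 by (simp add: Suc_le_eq card_gt_0_iff) blast
    ultimately show "real (card X) * (real (card X) - 1) = real l * (real (card K) - 1)"
      by (simp add: power2_eq_square of_nat_diff algebra_simps)
  qed (use l that in auto)
  obtain l where l: "\<forall>g\<in>K - {0}. diff_count X g = l"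
    using assms by (auto simp: difference_set_def)
  show thesis
  proof (cases "card K = 1")
    case True
    then have "K = {0}" using 0 by (auto simp: card_1_singleton_iff)
    then show thesis by (intro *[of 0]) auto
  qed (use l * in auto)
qed

section \<open>The combinatorial structure of a composite difference set\<close>

locale composite_difference_set =
  fixes H A B D :: "'g::{finite,ab_group_add} set"
  assumes via: "composite_via H A B D"
begin

abbreviation S :: nat where "S \<equiv> card A"

lemma fine_H: "fine H D" and fine_S_eq: "fine_S D = real S" and B_ds: "difference_set H B"
  and conv: "indicator D = (convolution (indicator A) (indicator B) :: 'g \<Rightarrow> complex)"
  using via by (auto simp: composite_via_def)

lemma D_ds: "difference_set UNIV D" and D_ne: "D \<noteq> {}" and H_sub: "is_subgroup H"
  and D_disj: "D \<inter> H = {}"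
  and card_H_eq: "real (card H) = real CARD('g) / (real S + 1)"
  using fine_H fine_S_eq by (auto simp: fine_def)

lemma B_sub: "B \<subseteq> H"
  using B_ds by (simp add: difference_set_def)

lemma zero_in: "0 \<in> H" and add_in: "x \<in> H \<Longrightarrow> y \<in> H \<Longrightarrow> x + y \<in> H"
  and minus_in: "x \<in> H \<Longrightarrow> - x \<in> H"
  using H_sub by (auto simp: is_subgroup_def)

lemmas diff_in = is_subgroup_diff[OF H_sub]
lemmas diff_swap = is_subgroup_diff_swap[OF H_sub]
lemmas diff_trans = is_subgroup_diff_trans[OF H_sub]

lemma card_H_pos: "card H > 0"
  using zero_in by (auto simp: card_gt_0_iff)

text \<open>At \<open>g\<close> the convolution counts the pairs with sum \<open>g\<close>, and as
  an indicator it is 0 or 1. This moves the complex identity to the natural numbers.\<close>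

lemma representations:
  "card {p \<in> A \<times> B. fst p + snd p = g} = of_bool (g \<in> D)"
proof -
  have "(indicator D g :: complex) = (\<Sum>a\<in>UNIV. indicator A a * indicator B (g - a))"
    by (simp add: conv convolution_def)
  also have "\<dots> = (\<Sum>a\<in>A. \<Sum>b\<in>B. of_bool (a + b = g))"
  proof -
    have *: "(\<Sum>b\<in>B. of_bool (a + b = g)) = (indicator B (g - a) :: complex)" for a
    proof -
      have "(\<Sum>b\<in>B. of_bool (a + b = g)) = (\<Sum>b\<in>B. of_bool (b = g - a) :: complex)"
        by (intro sum.cong refl arg_cong[where f = of_bool]) (auto simp: algebra_simps)
      then show ?thesis by (simp add: of_bool_def indicator_def)
    qed
    show ?thesis
      by (simp only: *) (simp add: indicator_def if_distrib[of "\<lambda>c. c * _"] sum.If_cases cong: if_cong)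
  qed
  also have "\<dots> = (\<Sum>p\<in>A \<times> B. of_bool (fst p + snd p = g))"
    by (simp add: sum.cartesian_product split_def del: sum_of_bool_eq)
  also have "\<dots> = of_nat (card {p \<in> A \<times> B. fst p + snd p = g})"
    by (simp only: sum_of_bool_card finite of_nat_id)
  finally have "of_nat (card {p \<in> A \<times> B. fst p + snd p = g}) = (of_nat (of_bool (g \<in> D)) :: complex)"
    by (simp add: indicator_def)
  then show ?thesis by (simp only: of_nat_eq_iff)
qed

text \<open>A number of representations that is at most one gives injectivity; its being nonzero
  exactly on \<open>D\<close> gives the image.\<close>

lemma bij_sum: "bij_betw (\<lambda>(a, b). a + b) (A \<times> B) D"
proof (rule bij_betw_imageI)
  have fin: "finite {p \<in> A \<times> B. fst p + snd p = g}" for g by simp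
  show "inj_on (\<lambda>(a, b). a + b) (A \<times> B)"
  proof (rule inj_onI)
    fix p q assume pq: "p \<in> A \<times> B" "q \<in> A \<times> B" "(\<lambda>(a, b). a + b) p = (\<lambda>(a, b). a + b) q"
    let ?T = "{p' \<in> A \<times> B. fst p' + snd p' = fst p + snd p}"
    have "card ?T \<le> Suc 0" by (simp only: representations of_bool_def) auto
    then have "\<forall>x\<in>?T. \<forall>y\<in>?T. x = y" by (simp only: card_le_Suc0_iff_eq[OF fin])
    moreover have "p \<in> ?T" "q \<in> ?T" using pq by (simp_all add: split_def)
    ultimately show "p = q" by blast
  qed
  show "(\<lambda>(a, b). a + b) ` (A \<times> B) = D"
  proof -
    have D: "g \<in> D \<longleftrightarrow> {p \<in> A \<times> B. fst p + snd p = g} \<noteq> {}" for g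
      using card_0_eq[OF fin[of g]] representations[of g] by (cases "g \<in> D") simp_all
    show ?thesis unfolding set_eq_iff D image_iff split_def by blast
  qed
qed

lemma sum_over_D: "(\<Sum>d\<in>D. f d) = (\<Sum>a\<in>A. \<Sum>b\<in>B. f (a + b))"
  using sum.reindex_bij_betw[OF bij_sum, of f] by (simp add: sum.cartesian_product split_def)

lemma in_D_iff: "d \<in> D \<longleftrightarrow> (\<exists>a\<in>A. \<exists>b\<in>B. d = a + b)"
  using bij_sum by (force simp: bij_betw_def)

lemma card_D: "card D = S * card B"
  using bij_betw_same_card[OF bij_sum] by (simp add: card_cartesian_product)

lemma S_pos: "S > 0" and card_B_pos: "card B > 0"
proof -
  have "card D > 0" using D_ne by (simp add: card_gt_0_iff)
  then show "S > 0" "card B > 0" by (auto simp: card_D)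
qed

lemma S_nonzero: "real S \<noteq> 0"
  using S_pos by linarith

lemma B_nonzero: "real (card B) \<noteq> 0"
  using card_B_pos by linarith

lemma H_nonzero: "real (card H) \<noteq> 0"
  using card_H_pos by linarith

lemma A_disj: "A \<inter> H = {}"
proof (rule ccontr)
  assume "A \<inter> H \<noteq> {}"
  then obtain a where a: "a \<in> A" "a \<in> H" by auto
  obtain b where "b \<in> B" using card_B_pos by (auto simp: card_gt_0_iff)
  then have "a + b \<in> D \<inter> H" using a B_sub by (auto simp: in_D_iff intro: add_in)
  with D_disj show False by simp
qed

section \<open>Relations between the cardinalities\<close>

lemma card_G: "CARD('g) = card H * (S + 1)"
proof -
  have "real CARD('g) = real (card H * (S + 1))"
    using card_H_eq by (simp add: field_simps)
  then show ?thesis by (simp only: of_nat_eq_iff)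
qed

text \<open>\<open>D\<close> misses 0 because \<open>H\<close> contains it. Hence the denominator in
  \<open>fine_S\<close> is positive.\<close>

lemma card_D_less: "card D < CARD('g)"
proof -
  have "D \<subset> UNIV" using D_disj zero_in by auto
  then show ?thesis by (metis finite psubset_card_mono)
qed

lemma fine_S_square:
  "(real S)\<^sup>2 * (real CARD('g) - real (card D)) = real (card D) * (real CARD('g) - 1)"
proof -
  let ?r = "real (card D) * (real CARD('g) - 1) / (real CARD('g) - real (card D))"
  have "?r \<ge> 0" using card_D_less by (intro divide_nonneg_nonneg mult_nonneg_nonneg) auto
  then have "(real S)\<^sup>2 = ?r" using fine_S_eq by (simp add: fine_S_def flip: fine_S_eq)
  then show ?thesis using card_D_less by (simp add: field_simps)
qed

text \<open>With \<open>card D = S * card B\<close> and \<open>CARD('g) = card H * (S + 1)\<close>,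
  the equation that defines \<open>S\<close> loses a common factor \<open>S\<close> and then a
  factor \<open>S + 1\<close>.\<close>

lemma card_relation:
  "real (card H) * (real S - real (card B)) = real (card B) * (real S - 1)"
proof -
  let ?S = "real S" and ?k = "real (card B)" and ?h = "real (card H)"
  have "?S * (?S * (?h * (?S + 1) - ?S * ?k)) = ?S * (?k * (?h * (?S + 1) - 1))"
    using fine_S_square by (simp add: card_D card_G power2_eq_square algebra_simps)
  then have "?S * (?h * (?S + 1) - ?S * ?k) = ?k * (?h * (?S + 1) - 1)"
    by (simp only: mult_cancel_left S_nonzero simp_thms)
  then have "(?S + 1) * (?h * (?S - ?k)) = (?S + 1) * (?k * (?S - 1))"
    by (simp add: algebra_simps)
  moreover have "?S + 1 \<noteq> 0" by linarith
  ultimately show ?thesis by (simp only: mult_cancel_left) simp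
qed

text \<open>In the group ring, \<open>D\<close> times its reflection is the product of the
  corresponding elements for \<open>A\<close> and \<open>B\<close>.\<close>

lemma diff_count_D: "diff_count D g = (\<Sum>a\<in>A. \<Sum>a'\<in>A. diff_count B (g - (a - a')))"
proof -
  have "diff_count D g = (\<Sum>a\<in>A. \<Sum>b\<in>B. \<Sum>a'\<in>A. \<Sum>b'\<in>B. of_bool (a + b - (a' + b') = g))"
    by (simp only: diff_count_conv_sum sum_over_D)
  also have "\<dots> = (\<Sum>a\<in>A. \<Sum>a'\<in>A. \<Sum>b\<in>B. \<Sum>b'\<in>B. of_bool (b - b' = g - (a - a')))"
    by (subst sum.swap[of _ A B], intro sum.cong refl arg_cong[where f = of_bool])
      (auto simp: algebra_simps)
  finally show ?thesis by (simp only: diff_count_conv_sum)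
qed

text \<open>All differences of \<open>B\<close> lie in \<open>H\<close>. Shifted by \<open>t\<close>
  they stay in \<open>H\<close> if \<open>t\<close> is in \<open>H\<close>, so that every pair is
  counted, and otherwise they all leave it.\<close>

lemma sum_diff_count_B_coset:
  "(\<Sum>g\<in>H. diff_count B (g - t)) = of_bool (t \<in> H) * (card B)\<^sup>2"
proof -
  have "(\<Sum>g\<in>H. diff_count B (g - t)) = (\<Sum>g\<in>UNIV. of_bool (g \<in> H) * diff_count B (g - t))"
    by (simp add: of_bool_def if_distrib[of "\<lambda>c. c * _"] sum.If_cases cong: if_cong)
  also have "\<dots> = (\<Sum>g\<in>UNIV. of_bool (g + t \<in> H) * diff_count B g)"
    by (rule sum.reindex_bij_witness[of _ "\<lambda>g. g + t" "\<lambda>g. g - t"]) auto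
  also have "\<dots> = (\<Sum>g\<in>UNIV. of_bool (t \<in> H) * diff_count B g)"
  proof (intro sum.cong refl)
    fix g
    show "of_bool (g + t \<in> H) * diff_count B g = of_bool (t \<in> H) * diff_count B g"
    proof (cases "g \<in> H")
      case True
      then have "g + t \<in> H \<longleftrightarrow> t \<in> H" using add_in diff_in[of "g + t" g] by auto
      then show ?thesis by simp
    qed (simp add: diff_count_outside[OF H_sub B_sub])
  qed
  finally show ?thesis by (simp add: sum_diff_count_univ flip: sum_distrib_left)
qed

lemma index_D:
  obtains l where "\<And>g. g \<noteq> 0 \<Longrightarrow> diff_count D g = l"
    "real l * real (card H) = (real (card B))\<^sup>2 * (real S - 1)"
proof -
  let ?S = "real S" and ?k = "real (card B)" and ?h = "real (card H)"
  have "is_subgroup (UNIV :: 'g set)" by (simp add: is_subgroup_def)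
  then obtain l where l: "\<And>g. g \<in> UNIV - {0} \<Longrightarrow> diff_count D g = l"
      and eq: "real (card D) * (real (card D) - 1) = real l * (real CARD('g) - 1)"
    using difference_set_index[OF _ D_ds] by metis
  have G1: "real CARD('g) - 1 > 0"
  proof -
    have "card D > 0" using S_pos card_B_pos by (simp only: card_D nat_0_less_mult_iff)
    then show ?thesis using card_D_less by linarith
  qed
  \<comment> \<open>Write n for the order of the group, d for \<open>card D\<close>, and k, h for
    \<open>card B\<close> and \<open>card H\<close>. Facts \<open>1\<close> and \<open>2\<close> say
    that k (n - 1) = S (n - d) and h (d - 1) = (S - 1) (n - d). Combined with d (d - 1) = l (n - 1),
    they allow n - d to be eliminated.\<close>
  have 1: "?k * (real CARD('g) - 1) = ?S * (?h * (?S + 1) - ?S * ?k)"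
  proof -
    have "?S * (?k * (real CARD('g) - 1)) = ?S * (?S * (?h * (?S + 1) - ?S * ?k))"
      using fine_S_square by (simp add: card_D card_G power2_eq_square algebra_simps)
    then show ?thesis by (simp only: mult_cancel_left S_nonzero simp_thms)
  qed
  have 2: "?h * (?S * ?k - 1) = (?S - 1) * (?h * (?S + 1) - ?S * ?k)"
    using card_relation by algebra
  have "(real CARD('g) - 1) * (real l * ?h) = ?h * (?S * ?k - 1) * (?S * ?k)"
    using eq unfolding card_D of_nat_mult by algebra
  also have "\<dots> = (real CARD('g) - 1) * (?k\<^sup>2 * (?S - 1))"
    using 1 2 by algebra
  finally have "(real CARD('g) - 1) * (real l * ?h) = (real CARD('g) - 1) * (?k\<^sup>2 * (?S - 1))" .
  then have "real l * ?h = ?k\<^sup>2 * (?S - 1)" using G1 by simp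
  with l that show thesis by simp
qed

text \<open>Summing the difference counts of \<open>D\<close> over \<open>H\<close> in two ways gives
  \<open>#{(a, a'). a - a' \<in> H} = S\<close>, so that only the diagonal pairs contribute.\<close>

lemma A_distinct_cosets:
  assumes "a \<in> A" "a' \<in> A" "a - a' \<in> H"
  shows "a = a'"
proof -
  obtain l where l: "\<And>g. g \<noteq> 0 \<Longrightarrow> diff_count D g = l"
    and lH: "real l * real (card H) = (real (card B))\<^sup>2 * (real S - 1)"
    using index_D by metis
  let ?P = "{p \<in> A \<times> A. fst p - snd p \<in> H}"
  have "(\<Sum>g\<in>H. diff_count D g) = (\<Sum>g\<in>H. \<Sum>p\<in>A \<times> A. diff_count B (g - (fst p - snd p)))"
    by (simp add: diff_count_D sum.cartesian_product split_def)
  also have "\<dots> = (\<Sum>p\<in>A \<times> A. of_bool (fst p - snd p \<in> H) * (card B)\<^sup>2)"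
    by (subst sum.swap) (simp only: sum_diff_count_B_coset)
  also have "\<dots> = card ?P * (card B)\<^sup>2"
    by (simp only: sum_of_bool_card finite of_nat_id flip: sum_distrib_right)
  finally have "card ?P * (card B)\<^sup>2 = (\<Sum>g\<in>H. diff_count D g)" by simp
  also have "\<dots> = card D + l * (card H - 1)"
    using zero_in l by (simp add: sum.remove[of H 0] diff_count_0 mult.commute)
  finally have "real (card ?P) * (real (card B))\<^sup>2 = real S * real (card B) + real l * real (card H - 1)"
    unfolding card_D by (simp flip: of_nat_mult of_nat_add of_nat_power)
  moreover have "real (card H - 1) = real (card H) - 1" using card_H_pos by simp
  ultimately have "real (card ?P) * (real (card B))\<^sup>2
      = real S * real (card B) - real l + (real (card B))\<^sup>2 * (real S - 1)"
    using lH by algebra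
  \<comment> \<open>Replacing \<open>card B * (S - 1)\<close> by
    \<open>card H * (S - card B)\<close> in the formula for \<open>l\<close> exposes a factor
    \<open>card H\<close> that cancels. The terms linear in \<open>card B\<close> then drop out of
    the count.\<close>
  moreover have "real l = real S * real (card B) - (real (card B))\<^sup>2"
  proof -
    have "real (card H) * real l = real (card H) * (real S * real (card B) - (real (card B))\<^sup>2)"
      using lH card_relation by algebra
    then show ?thesis by (simp only: mult_cancel_left H_nonzero simp_thms)
  qed
  ultimately have "real (card ?P) * (real (card B))\<^sup>2 = real S * (real (card B))\<^sup>2"
    by (simp add: algebra_simps)
  then have "card ?P = S"
    by (simp only: mult_cancel_right power_eq_0_iff B_nonzero simp_thms of_nat_eq_iff)
  moreover have "card ((\<lambda>a. (a, a)) ` A) = S" by (simp add: card_image inj_on_def)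
  moreover have "(\<lambda>a. (a, a)) ` A \<subseteq> ?P" using zero_in by auto
  ultimately have eq: "(\<lambda>a. (a, a)) ` A = ?P" by (intro card_subset_eq) auto
  have "(a, a') \<in> ?P" using assms by simp
  then have "(a, a') \<in> (\<lambda>a. (a, a)) ` A" unfolding eq .
  then show ?thesis by auto
qed

text \<open>The elements of \<open>insert 0 A\<close> lie in \<open>S + 1\<close> different cosets
  of \<open>H\<close>, and \<open>S + 1\<close> is the index of \<open>H\<close>, so these cosets
  cover the group. The coset of 0 is excluded by the assumption on \<open>g\<close>.\<close>

lemma A_transversal:
  assumes "g \<notin> H"
  obtains a where "a \<in> A" "a - g \<in> H"
proof -
  have "inj_on (\<lambda>(a, h). a + h) (insert 0 A \<times> H)"
  proof (rule inj_onI, clarify)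
    fix a h a' h' assume *: "a \<in> insert 0 A" "a' \<in> insert 0 A" "h \<in> H" "h' \<in> H" "a + h = a' + h'"
    then have "a - a' = h' - h" by (simp add: algebra_simps)
    then have "a - a' \<in> H" using * diff_in by simp
    moreover from this have "a' - a \<in> H" by (rule diff_swap)
    ultimately have "a = a'"
      using * A_disj A_distinct_cosets by auto
    then show "a = a' \<and> h = h'" using * by simp
  qed
  then have "card ((\<lambda>(a, h). a + h) ` (insert 0 A \<times> H)) = card (insert 0 A) * card H"
    by (simp add: card_image card_cartesian_product)
  moreover have "0 \<notin> A" using A_disj zero_in by auto
  ultimately have "card ((\<lambda>(a, h). a + h) ` (insert 0 A \<times> H)) = CARD('g)"
    by (simp add: card_G)
  then have "(\<lambda>(a, h). a + h) ` (insert 0 A \<times> H) = UNIV"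
    by (intro card_subset_eq) auto
  then have "g \<in> (\<lambda>(a, h). a + h) ` (insert 0 A \<times> H)" by simp
  then obtain a h where "a \<in> insert 0 A" "h \<in> H" "g = a + h" by auto
  with assms that[of a] minus_in show thesis by auto
qed

text \<open>The condition on a pair (a, a') says that a' lies in the coset of \<open>a - g\<close>.
  There is exactly one such a' in \<open>A\<close>, except when that coset is \<open>H\<close>
  itself, which happens only for the representative \<open>a0\<close> of the coset of
  \<open>g\<close>.\<close>

lemma card_coset_pairs:
  assumes "g \<notin> H"
  shows "card {p \<in> A \<times> A. g - (fst p - snd p) \<in> H} = S - 1"
proof -
  let ?P = "{p \<in> A \<times> A. g - (fst p - snd p) \<in> H}"
  obtain a0 where a0: "a0 \<in> A" "a0 - g \<in> H" using A_transversal[OF assms] .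
  have inj: "inj_on fst ?P"
  proof (rule inj_onI)
    fix p q assume "p \<in> ?P" "q \<in> ?P" "fst p = fst q"
    then have "snd p - snd q \<in> H" using diff_in[of "g - (fst p - snd p)" "g - (fst q - snd q)"] by simp
    then show "p = q" using \<open>p \<in> ?P\<close> \<open>q \<in> ?P\<close> \<open>fst p = fst q\<close> A_distinct_cosets
      by (auto simp: prod_eq_iff)
  qed
  have img: "fst ` ?P = A - {a0}"
  proof (intro equalityI subsetI)
    fix a assume "a \<in> fst ` ?P"
    then obtain a' where *: "a \<in> A" "a' \<in> A" "g - (a - a') \<in> H" by auto
    have "a \<noteq> a0"
    proof
      assume "a = a0"
      then have "a' \<in> H" using add_in[OF *(3) a0(2)] by simp
      with * A_disj show False by auto
    qed
    with * show "a \<in> A - {a0}" by simp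
  next
    fix a assume a: "a \<in> A - {a0}"
    have "a - g \<notin> H"
    proof
      assume "a - g \<in> H"
      then have "a - a0 \<in> H" using diff_in[OF _ a0(2), of "a - g"] by simp
      with a a0 A_distinct_cosets show False by auto
    qed
    then obtain a' where "a' \<in> A" "a' - (a - g) \<in> H" using A_transversal by blast
    then have "(a, a') \<in> ?P" using a by (simp add: algebra_simps)
    then show "a \<in> fst ` ?P" by force
  qed
  have "card ?P = card (A - {a0})" using card_image[OF inj] unfolding img by (rule sym)
  then show ?thesis using a0 by simp
qed

text \<open>\<open>card B - l\<close> is the order of the difference set \<open>B\<close>. For
  nontrivial \<open>H\<close> the cardinality relations force it to be
  \<open>(card B)\<^sup>2\<close> divided by \<open>S\<close>, which is positive; for trivial
  \<open>H\<close> positivity comes from \<open>l = 0\<close>. The same number is later the squared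
  modulus of character sums over \<open>B\<close>.\<close>

lemma index_B:
  obtains l where "\<And>g. g \<in> H - {0} \<Longrightarrow> diff_count B g = l" "real (card B) - real l > 0"
    "real l * real (card H) = (real (card B))\<^sup>2 - (real (card B) - real l)"
    "card H \<noteq> 1 \<Longrightarrow> (real (card B) - real l) * real S = (real (card B))\<^sup>2"
proof -
  let ?S = "real S" and ?k = "real (card B)" and ?h = "real (card H)"
  obtain l where l: "\<And>g. g \<in> H - {0} \<Longrightarrow> diff_count B g = l"
      and eq: "?k * (?k - 1) = real l * (?h - 1)" and triv: "card H = 1 \<Longrightarrow> l = 0"
    using difference_set_index[OF H_sub B_ds] by metis
  have S: "(?k - real l) * ?S = ?k\<^sup>2" if "card H \<noteq> 1"
  proof -
    have "?h - 1 \<noteq> 0" using that by simp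
    moreover have "(?h - 1) * ((?k - real l) * ?S) = (?h - 1) * ?k\<^sup>2"
      using eq card_relation unfolding power2_eq_square by algebra
    ultimately show ?thesis by simp
  qed
  have pos: "?k - real l > 0"
  proof (cases "card H = 1")
    case True
    then show ?thesis using triv card_B_pos by simp
  next
    case False
    then have "(?k - real l) * ?S > 0" using S B_nonzero by simp
    then show ?thesis using S_pos by (simp add: zero_less_mult_iff)
  qed
  have "real l * ?h = ?k\<^sup>2 - (?k - real l)"
    using eq by (simp add: power2_eq_square algebra_simps)
  with l S pos that show thesis by blast
qed

text \<open>The difference counts of \<open>B\<close> are a multiple of the indicator of 0 plus a
  multiple of the indicator of \<open>H\<close>. Inserted in \<open>diff_count_D\<close>, the first
  part yields the unknown count of \<open>A\<close> and the second the number of pairs from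
  \<open>card_coset_pairs\<close>. The coefficient of the unknown is nonzero, so it can be solved
  for.\<close>

lemma diff_count_A:
  assumes "g \<notin> H"
  shows "real (diff_count A g) * real (card H) = real S - 1"
proof -
  let ?k = "real (card B)" and ?h = "real (card H)" and ?F = "real (diff_count A g)"
  obtain l where l: "\<And>g. g \<noteq> 0 \<Longrightarrow> diff_count D g = l"
    and lH: "real l * ?h = ?k\<^sup>2 * (real S - 1)"
    using index_D by metis
  obtain m where m: "\<And>g. g \<in> H - {0} \<Longrightarrow> diff_count B g = m" and pos: "?k - real m > 0"
    and mH: "real m * ?h = ?k\<^sup>2 - (?k - real m)"
    using index_B by metis
  have B: "real (diff_count B t) = (?k - real m) * of_bool (t = 0) + real m * of_bool (t \<in> H)" for t
  proof -
    consider "t = 0" | "t \<in> H - {0}" | "t \<notin> H" using zero_in by blast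
    then show ?thesis
      using m zero_in diff_count_outside[OF H_sub B_sub, of t] by cases (auto simp: diff_count_0)
  qed
  have "real l = real (diff_count D g)" using l assms zero_in by metis
  also have "\<dots> = (\<Sum>p\<in>A \<times> A. real (diff_count B (g - (fst p - snd p))))"
    by (simp add: diff_count_D sum.cartesian_product split_def)
  also have "\<dots> = (?k - real m) * (\<Sum>p\<in>A \<times> A. of_bool (g - (fst p - snd p) = 0))
      + real m * (\<Sum>p\<in>A \<times> A. of_bool (g - (fst p - snd p) \<in> H))"
    by (simp only: B sum.distrib sum_distrib_left)
  also have "(\<Sum>p\<in>A \<times> A. of_bool (g - (fst p - snd p) \<in> H)) = real S - 1"
  proof -
    have "(\<Sum>p\<in>A \<times> A. of_bool (g - (fst p - snd p) \<in> H))
        = real (card {p \<in> A \<times> A. g - (fst p - snd p) \<in> H})"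
      by (simp only: sum_of_bool_card finite of_nat_id)
    then show ?thesis using S_pos by (simp add: card_coset_pairs[OF assms] of_nat_diff del: sum_of_bool_eq)
  qed
  also have "(\<Sum>p\<in>A \<times> A. of_bool (g - (fst p - snd p) = 0)) = ?F"
  proof -
    have "(\<Sum>p\<in>A \<times> A. of_bool (g - (fst p - snd p) = 0))
        = (\<Sum>x\<in>A. \<Sum>y\<in>A. of_bool (x - y = g) :: real)"
      unfolding sum.cartesian_product
      by (intro sum.cong refl) (auto simp: of_bool_def)
    then show ?thesis by (simp add: diff_count_conv_sum)
  qed
  finally have "real l = (?k - real m) * ?F + real m * (real S - 1)" .
  then have "(?k - real m) * (?F * ?h) = (?k - real m) * (real S - 1)"
    using lH mH by algebra
  then show ?thesis using pos by simp
qed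

lemma rds: "relative_difference_set H A (real S + 1) (real (card H)) (real S)
  ((real S - 1) / real (card H))"
proof -
  have "\<not> (\<exists>a\<in>A. \<exists>a'\<in>A. g = a - a')" if "g \<in> H - {0}" for g
    using that A_distinct_cosets by auto
  moreover have "real CARD('g) / real (card H) = real S + 1"
    using card_G H_nonzero by (simp add: field_simps)
  ultimately show ?thesis
    using H_sub H_nonzero diff_count_A
    by (auto simp: relative_difference_set_def eq_divide_eq)
qed

text \<open>The quotient is the index \<open>m\<close> of the relative difference set
  \<open>A\<close>. It is an integer because it counts the differences equal to some element outside
  \<open>H\<close>, and any member of \<open>A\<close> is such an element.\<close>

lemma complement_dvd: "(int CARD('g) - int (card D)) dvd (int (card D) - 1)"
proof -
  obtain a where "a \<in> A" using S_pos by (auto simp: card_gt_0_iff)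
  then have "a \<notin> H" using A_disj by auto
  define m where "m = diff_count A a"
  have m: "real m * real (card H) = real S - 1"
    unfolding m_def by (rule diff_count_A) fact
  then have "real_of_int (int S) = real_of_int (int m * int (card H) + 1)" by simp
  then have 1: "int S = int m * int (card H) + 1" by (simp only: of_int_eq_iff)
  have "real_of_int (int (card H) * (int S - int (card B)))
      = real_of_int (int (card B) * (int S - 1))"
    using card_relation by simp
  then have "int (card H) * (int S - int (card B)) = int (card B) * (int S - 1)"
    by (simp only: of_int_eq_iff)
  then have "int (card H) * int S = int (card H) * (int m * int (card B) + int (card B))"
    unfolding 1 by (simp add: algebra_simps)
  then have 2: "int S = int m * int (card B) + int (card B)"
    using H_nonzero by (simp only: mult_cancel_left of_nat_eq_0_iff simp_thms)
  have "int (card D) - 1 = int m * (int CARD('g) - int (card D))"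
    using 1 2 unfolding card_D card_G of_nat_mult of_nat_add of_nat_1 by algebra
  then show ?thesis by simp
qed

section \<open>Slices of \<open>D\<close> by the cosets of \<open>H\<close>\<close>

lemma slice_eq:
  assumes "a \<in> A" "a - g \<in> H"
  shows "slice H D g = (+) (a - g) ` B"
proof (intro equalityI subsetI)
  fix x assume "x \<in> slice H D g"
  then obtain a' b where *: "x \<in> H" "a' \<in> A" "b \<in> B" "x = a' + b - g"
    by (auto simp: slice_def in_D_iff)
  then have "a' - g = x - b" by simp
  moreover have "x - b \<in> H" using * B_sub diff_in by blast
  ultimately have "a' - g \<in> H" by simp
  \<comment> \<open>Both \<open>a'\<close> and \<open>a\<close> represent the coset of
    \<open>g\<close>, and \<open>A\<close> has only one element there.\<close>
  then have "a' - a \<in> H" using assms diff_swap diff_trans by blast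
  then have "a' = a" using * assms A_distinct_cosets by blast
  then show "x \<in> (+) (a - g) ` B" using * by (auto simp: algebra_simps)
next
  fix x assume "x \<in> (+) (a - g) ` B"
  then obtain b where b: "b \<in> B" "x = (a - g) + b" by auto
  then have "x \<in> H" using add_in[OF assms(2)] B_sub by auto
  moreover have "a + b \<in> D" using assms b in_D_iff by blast
  moreover have "x = (a + b) - g" using b by simp
  ultimately show "x \<in> slice H D g" unfolding slice_def by blast
qed

lemma slice_A: "a \<in> A \<Longrightarrow> slice H D a = B"
  using slice_eq[of a a] zero_in by simp

text \<open>For \<open>g\<close> in \<open>H\<close> the slice is empty because \<open>D\<close>
  avoids \<open>H\<close>. Any other slice is a translate of \<open>B\<close>, and translation
  preserves difference counts.\<close>

lemma amalgam_via: "amalgam_via H D"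
  unfolding amalgam_via_def
proof (intro conjI allI)
  show "fine H D" by (rule fine_H)
  fix g
  show "difference_set H (slice H D g)"
  proof (cases "g \<in> H")
    case True
    have "slice H D g = {}"
    proof (rule ccontr)
      assume "slice H D g \<noteq> {}"
      then obtain d where "d \<in> D" "d - g \<in> H" by (auto simp: slice_def)
      then have "d \<in> D \<inter> H" using add_in[OF _ True, of "d - g"] by simp
      with D_disj show False by simp
    qed
    then show ?thesis by (simp add: difference_set_def diff_count_def)
  next
    case False
    then obtain a where "a \<in> A" "a - g \<in> H" using A_transversal by blast
    then have "slice H D g = (+) (a - g) ` B" by (rule slice_eq)
    moreover have "slice H D g \<subseteq> H" by (simp add: slice_def)
    ultimately show ?thesis using B_ds by (simp add: difference_set_def diff_count_translate)
  qed
qed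

end

section \<open>Characters of a finite abelian group\<close>

lemma
  assumes "\<gamma> \<in> characters"
  shows character_norm: "cmod (\<gamma> x) = 1"
    and character_add: "\<gamma> (x + y) = \<gamma> x * \<gamma> y"
    and character_0: "\<gamma> 0 = 1"
    and character_minus: "\<gamma> (- x) = cnj (\<gamma> x)"
    and character_cnj_mult: "cnj (\<gamma> x) * \<gamma> x = 1"
proof -
  have n: "cmod (\<gamma> x) = 1" and a: "\<gamma> (x + y) = \<gamma> x * \<gamma> y" for x y
    using assms by (auto simp: characters_def)
  then show "cmod (\<gamma> x) = 1" "\<gamma> (x + y) = \<gamma> x * \<gamma> y" by auto
  have "\<gamma> 0 * \<gamma> 0 = \<gamma> 0" using a[of 0 0] by simp
  moreover have "\<gamma> 0 \<noteq> 0" using n[of 0] by auto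
  ultimately show 0: "\<gamma> 0 = 1" by simp
  show c: "cnj (\<gamma> x) * \<gamma> x = 1"
    using complex_norm_square[of "\<gamma> x"] n[of x] by (simp add: mult.commute)
  have "\<gamma> (- x) * \<gamma> x = 1" using a[of "- x" x] 0 by simp
  then have "\<gamma> (- x) * \<gamma> x = cnj (\<gamma> x) * \<gamma> x" using c by simp
  moreover have "\<gamma> x \<noteq> 0" using n[of x] by auto
  ultimately show "\<gamma> (- x) = cnj (\<gamma> x)" by simp
qed

lemma characters_mult: "\<gamma> \<in> characters \<Longrightarrow> \<gamma>' \<in> characters \<Longrightarrow> \<gamma> * \<gamma>' \<in> characters"
  by (auto simp: characters_def norm_mult)

lemma characters_cnj: "\<gamma> \<in> characters \<Longrightarrow> (\<lambda>x. cnj (\<gamma> x)) \<in> characters"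
  by (auto simp: characters_def)

section \<open>Extending characters from subgroups\<close>

primrec nmult :: "nat \<Rightarrow> 'g::ab_group_add \<Rightarrow> 'g" where
  "nmult 0 x = 0"
| "nmult (Suc n) x = x + nmult n x"

lemma nmult_add: "nmult (m + n) x = nmult m x + nmult n x"
  by (induction m) (auto simp: algebra_simps)

lemma nmult_mult: "nmult (m * n) x = nmult m (nmult n x)"
  by (induction m) (auto simp: nmult_add)

lemma nmult_in: "is_subgroup K \<Longrightarrow> x \<in> K \<Longrightarrow> nmult n x \<in> K"
  by (induction n) (auto simp: is_subgroup_def)

text \<open>The multiples of \<open>x\<close> lie in a finite group, so two of them
  coincide.\<close>

lemma nmult_eq_0:
  fixes x :: "'g::{finite,ab_group_add}"
  obtains n where "n > 0" "nmult n x = 0"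
proof -
  have "\<not> inj (\<lambda>n. nmult n x)"
    using finite_imageD[of "\<lambda>n. nmult n x" UNIV] by auto
  then obtain i j where "nmult i x = nmult j x" "i < j"
    by (metis injI linorder_neqE_nat)
  then have "nmult (j - i) x = 0"
    using nmult_add[of "j - i" i x] by simp
  with \<open>i < j\<close> that[of "j - i"] show thesis by simp
qed

text \<open>Values outside \<open>K\<close> are left free. A character of a subgroup thus keeps the
  type of functions on the whole group while it is extended step by step.\<close>

definition character_on :: "'g::ab_group_add set \<Rightarrow> ('g \<Rightarrow> complex) \<Rightarrow> bool" where
  "character_on K \<chi> \<longleftrightarrow> (\<forall>x\<in>K. cmod (\<chi> x) = 1) \<and> (\<forall>x\<in>K. \<forall>y\<in>K. \<chi> (x + y) = \<chi> x * \<chi> y)"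

lemma character_on_nmult:
  assumes "is_subgroup K" "character_on K \<chi>" "x \<in> K"
  shows "\<chi> (nmult n x) = \<chi> x ^ n"
proof (induction n)
  case 0
  have "\<chi> 0 * \<chi> 0 = \<chi> 0" "\<chi> 0 \<noteq> 0"
    using assms unfolding is_subgroup_def character_on_def
    by (metis add_0, metis norm_zero zero_neq_one)
  then show ?case by simp
next
  case (Suc n)
  then show ?case using assms nmult_in[of K x n] by (simp add: character_on_def)
qed

text \<open>This is the order of \<open>x\<close> in the quotient by \<open>K\<close>, obtained
  without forming the quotient: the least positive \<open>m\<close> with the multiple in
  \<open>K\<close>. Division with remainder gives the divisibility.\<close>

lemma order_mod_subgroup:
  fixes x :: "'g::{finite,ab_group_add}"
  assumes "is_subgroup K"
  obtains m where "m > 0" "\<And>n. nmult n x \<in> K \<longleftrightarrow> m dvd n"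
proof -
  define m where "m = (LEAST n. n > 0 \<and> nmult n x \<in> K)"
  have 0: "0 \<in> K" using assms by (simp add: is_subgroup_def)
  have "\<exists>n. n > 0 \<and> nmult n x \<in> K" using nmult_eq_0[of x] 0 by metis
  then have m: "m > 0" "nmult m x \<in> K" unfolding m_def by (metis (mono_tags, lifting) LeastI_ex)+
  have "m dvd n" if "nmult n x \<in> K" for n
  proof -
    have "nmult n x - nmult (n div m) (nmult m x) \<in> K"
      by (rule is_subgroup_diff[OF assms that nmult_in[OF assms m(2)]])
    also have "nmult n x - nmult (n div m) (nmult m x) = nmult (n mod m) x"
      using nmult_add[of "n mod m" "n div m * m" x] by (simp add: nmult_mult)
    finally have "n mod m = 0"
      using m not_less_Least[of "n mod m" "\<lambda>n. n > 0 \<and> nmult n x \<in> K"] by (auto simp: m_def[symmetric])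
    then show ?thesis by auto
  qed
  moreover have "nmult n x \<in> K" if "m dvd n" for n
    using that nmult_in[OF assms m(2)] by (auto simp: mult.commute[of m] nmult_mult)
  ultimately show thesis using that[of m] m by blast
qed

text \<open>The value at the adjoined element \<open>x\<close>, of order \<open>m\<close> modulo \<open>K\<close>, may be any \<open>m\<close>-th root
  of \<open>\<chi> (m x)\<close>. Separation of points exploits this freedom.\<close>

lemma character_on_extend:
  fixes x :: "'g::{finite,ab_group_add}"
  assumes K: "is_subgroup K" and \<chi>: "character_on K \<chi>"
    and m: "m > 0" "\<And>n. nmult n x \<in> K \<longleftrightarrow> m dvd n" and w: "w ^ m = \<chi> (nmult m x)"
  obtains K' \<chi>' where "is_subgroup K'" "K \<subseteq> K'" "x \<in> K'" "character_on K' \<chi>'"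
    "\<And>k. k \<in> K \<Longrightarrow> \<chi>' k = \<chi> k" "\<chi>' x = w"
proof -
  have K0: "0 \<in> K" and Kadd: "\<And>x y. x \<in> K \<Longrightarrow> y \<in> K \<Longrightarrow> x + y \<in> K"
    using K by (auto simp: is_subgroup_def)
  have \<chi>n: "\<And>k. k \<in> K \<Longrightarrow> cmod (\<chi> k) = 1"
    and \<chi>add: "\<And>k l. k \<in> K \<Longrightarrow> l \<in> K \<Longrightarrow> \<chi> (k + l) = \<chi> k * \<chi> l"
    using \<chi> by (auto simp: character_on_def)
  have mx: "nmult m x \<in> K" using m by simp
  have "cmod w ^ m = 1" using w \<chi>n[OF mx] by (simp flip: norm_power)
  then have w1: "cmod w = 1" using m(1) power_eq_imp_eq_base[of "cmod w" m 1] by simp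
  define K' where "K' = {k + nmult n x | k n. k \<in> K}"
  \<comment> \<open>The multiples are natural, so the smaller exponent is taken first. The two
    representations then differ by a multiple of \<open>x\<close> lying in \<open>K\<close>, hence
    by a multiple of \<open>m\<close>, where the choice of \<open>w\<close> agrees with
    \<chi>.\<close>
  have wd': "\<chi> k * w ^ n = \<chi> k' * w ^ n'"
    if "k \<in> K" "k' \<in> K" "k + nmult n x = k' + nmult n' x" "n \<le> n'" for k k' n n'
  proof -
    have k: "k = k' + nmult (n' - n) x"
      using that nmult_add[of "n' - n" n x] by (simp add: algebra_simps)
    then have in_K: "nmult (n' - n) x \<in> K" using is_subgroup_diff[OF K that(1,2)] by simp
    then obtain q where q: "n' - n = q * m" using m by (metis dvdE mult.commute)
    have "\<chi> (nmult (n' - n) x) = w ^ (n' - n)"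
    proof -
      have "w ^ (n' - n) = \<chi> (nmult m x) ^ q"
        unfolding w[symmetric] q by (simp add: mult.commute flip: power_mult)
      then show ?thesis unfolding q nmult_mult using character_on_nmult[OF K \<chi> mx, of q] by simp
    qed
    then have "\<chi> k = \<chi> k' * w ^ (n' - n)" using k \<chi>add[OF that(2) in_K] by simp
    then show ?thesis using that(4) by (simp add: mult.assoc flip: power_add)
  qed
  have wd: "\<chi> k * w ^ n = \<chi> k' * w ^ n'"
    if "k \<in> K" "k' \<in> K" "k + nmult n x = k' + nmult n' x" for k k' n n'
    using wd'[of k k' n n'] wd'[of k' k n' n] that by (cases "n \<le> n'") auto
  \<comment> \<open>Any representation may be selected, since \<open>wd\<close> shows that the value
    does not depend on it.\<close>
  define \<chi>' where "\<chi>' y = (SOME z. \<exists>k\<in>K. \<exists>n. y = k + nmult n x \<and> z = \<chi> k * w ^ n)" for y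
  have \<chi>': "\<chi>' (k + nmult n x) = \<chi> k * w ^ n" if "k \<in> K" for k n
  proof -
    have "\<exists>k'\<in>K. \<exists>n'. k + nmult n x = k' + nmult n' x \<and> \<chi>' (k + nmult n x) = \<chi> k' * w ^ n'"
      unfolding \<chi>'_def by (rule someI_ex) (use that in blast)
    then show ?thesis using wd that by metis
  qed
  have K'_add: "(k + nmult n x) + (k' + nmult n' x) = (k + k') + nmult (n + n') x" for k k' n n'
    by (simp add: nmult_add algebra_simps)
  show thesis
  proof
    show "is_subgroup K'"
      unfolding is_subgroup_def
    proof (intro conjI ballI)
      show "0 \<in> K'" unfolding K'_def using K0 by (auto intro!: exI[of _ 0])
      show add: "y + z \<in> K'" if "y \<in> K'" "z \<in> K'" for y z
        using that K'_add Kadd unfolding K'_def by blast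
      show "- y \<in> K'" if "y \<in> K'" for y
      proof -
        \<comment> \<open>\<open>K'\<close> contains only natural multiples of \<open>x\<close>. As
          \<open>y\<close> has finite order, its negative is itself a natural multiple of
          \<open>y\<close>, so closure under addition suffices.\<close>
        obtain n where "n > 0" "nmult n y = 0" by (rule nmult_eq_0)
        then have "y + nmult (n - 1) y = 0" by (cases n) auto
        then have "- y = nmult (n - 1) y" by (metis add_left_cancel ab_group_add_class.ab_left_minus add.commute)
        moreover have "nmult j y \<in> K'" for j
          by (induction j) (use \<open>0 \<in> K'\<close> add that in auto)
        ultimately show ?thesis by simp
      qed
    qed
    show "K \<subseteq> K'" unfolding K'_def by (force intro: exI[of _ "0 :: nat"])
    have "x = 0 + nmult 1 x" by simp
    then show "x \<in> K'" unfolding K'_def using K0 by blast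
    show "\<chi>' k = \<chi> k" if "k \<in> K" for k using \<chi>'[OF that, of 0] by simp
    have "\<chi> 0 = 1" using character_on_nmult[OF K \<chi> K0, of 0] by simp
    then show "\<chi>' x = w" using \<chi>'[OF K0, of 1] by simp
    show "character_on K' \<chi>'"
      unfolding character_on_def
    proof (intro conjI ballI)
      show "cmod (\<chi>' y) = 1" if "y \<in> K'" for y
        using that \<chi>n w1 unfolding K'_def by (auto simp: \<chi>' norm_mult norm_power)
      show "\<chi>' (y + z) = \<chi>' y * \<chi>' z" if "y \<in> K'" "z \<in> K'" for y z
        using that Kadd \<chi>add unfolding K'_def by (auto simp: \<chi>' K'_add power_add)
    qed
  qed
qed

text \<open>One element is adjoined at a time, which lowers the number of elements outside the
  subgroup. Each step only needs a root of a complex number, and these always exist.\<close>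

lemma character_extend:
  fixes K :: "'g::{finite,ab_group_add} set"
  assumes "is_subgroup K" "character_on K \<chi>"
  obtains \<gamma> where "\<gamma> \<in> characters" "\<And>k. k \<in> K \<Longrightarrow> \<gamma> k = \<chi> k"
  using assms
proof (induction "card (- K)" arbitrary: K \<chi> thesis rule: less_induct)
  case less
  show thesis
  proof (cases "K = UNIV")
    case True
    then have "\<chi> \<in> characters" using less.prems by (auto simp: character_on_def characters_def)
    then show thesis using less.prems by blast
  next
    case False
    then obtain x where x: "x \<notin> K" by auto
    obtain m where m: "m > 0" "\<And>n. nmult n x \<in> K \<longleftrightarrow> m dvd n"
      using order_mod_subgroup[OF less.prems(2)] by metis
    then have "cmod (\<chi> (nmult m x)) = 1" using less.prems by (simp add: character_on_def)
    then have "card {w. w ^ m = \<chi> (nmult m x)} = m" using m by (intro card_nth_roots) auto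
    then have "{w. w ^ m = \<chi> (nmult m x)} \<noteq> {}" using m(1) by (intro notI) simp
    then obtain w where "w ^ m = \<chi> (nmult m x)" by blast
    then obtain K' \<chi>' where *: "is_subgroup K'" "K \<subseteq> K'" "x \<in> K'" "character_on K' \<chi>'"
        "\<And>k. k \<in> K \<Longrightarrow> \<chi>' k = \<chi> k"
      using character_on_extend[OF less.prems(2,3) m] by metis
    then have "card (- K') < card (- K)" using x by (intro psubset_card_mono) auto
    then obtain \<gamma> where "\<gamma> \<in> characters" "\<And>k. k \<in> K' \<Longrightarrow> \<gamma> k = \<chi>' k"
      using less.hyps[of K'] * by metis
    then show thesis using less.prems(1)[of \<gamma>] * by (metis subsetD)
  qed
qed

text \<open>The order \<open>m\<close> of \<open>x\<close> modulo \<open>H\<close> exceeds 1, so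
  there is an \<open>m\<close>-th root of unity other than 1. The trivial character of
  \<open>H\<close> extends with this root as its value at \<open>x\<close>.\<close>

lemma annihilator_separates:
  fixes H :: "'g::{finite,ab_group_add} set"
  assumes H: "is_subgroup H" and "x \<notin> H"
  obtains \<gamma> where "\<gamma> \<in> annihilator H" "\<gamma> x \<noteq> 1"
proof -
  have triv: "character_on H (\<lambda>_. 1)" by (simp add: character_on_def)
  obtain m where m: "m > 0" "\<And>n. nmult n x \<in> H \<longleftrightarrow> m dvd n"
    using order_mod_subgroup[OF H] by metis
  have "m \<noteq> 1" using m(2)[of 1] assms(2) by auto
  have "card {w :: complex. w ^ m = 1} = m" using card_roots_unity_eq m by blast
  then have "{w :: complex. w ^ m = 1} \<noteq> {1}" using \<open>m \<noteq> 1\<close> by auto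
  then obtain w :: complex where "w ^ m = 1" "w \<noteq> 1" by auto
  then obtain K \<chi> where K: "is_subgroup K" "H \<subseteq> K" "x \<in> K" "character_on K \<chi>"
      "\<And>k. k \<in> H \<Longrightarrow> \<chi> k = 1" "\<chi> x = w"
    using character_on_extend[OF H triv m, of w] by metis
  obtain \<gamma> where "\<gamma> \<in> characters" "\<And>k. k \<in> K \<Longrightarrow> \<gamma> k = \<chi> k"
    using character_extend[OF K(1,4)] by metis
  then have "\<gamma> \<in> annihilator H" "\<gamma> x \<noteq> 1"
    using K \<open>w \<noteq> 1\<close> by (auto simp: annihilator_def)
  then show thesis by (rule that)
qed

section \<open>Finiteness and orthogonality of characters\<close>

lemma character_power_card:
  fixes \<gamma> :: "'g::{finite,ab_group_add} \<Rightarrow> complex"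
  assumes "\<gamma> \<in> characters"
  shows "\<gamma> x ^ CARD('g) = 1"
proof -
  \<comment> \<open>Translation by \<open>x\<close> permutes the group, so the product of all
    values, which is nonzero, equals itself times the power in question.\<close>
  have "(\<Prod>y\<in>UNIV. \<gamma> y) = (\<Prod>y\<in>UNIV. \<gamma> (x + y))"
    by (rule prod.reindex_bij_witness[of _ "\<lambda>y. x + y" "\<lambda>y. y - x"]) auto
  also have "\<dots> = \<gamma> x ^ CARD('g) * (\<Prod>y\<in>UNIV. \<gamma> y)"
    by (simp add: character_add[OF assms] prod.distrib)
  finally show ?thesis
    using character_norm[OF assms]
    by (metis (no_types, lifting) mult_cancel_right1 finite norm_zero prod_zero_iff zero_neq_one)
qed

text \<open>The values of a character are among finitely many roots of unity. Sums over the
  annihilator are therefore genuine finite sums.\<close>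

lemma finite_characters: "finite (characters :: ('g::{finite,ab_group_add} \<Rightarrow> complex) set)"
proof (rule finite_subset)
  let ?R = "{z :: complex. z ^ CARD('g) = 1}"
  show "(characters :: ('g \<Rightarrow> complex) set) \<subseteq> {f. \<forall>x. (x \<in> UNIV \<longrightarrow> f x \<in> ?R) \<and> (x \<notin> UNIV \<longrightarrow> f x = 0)}"
    using character_power_card by auto
  show "finite {f :: 'g \<Rightarrow> complex. \<forall>x. (x \<in> UNIV \<longrightarrow> f x \<in> ?R) \<and> (x \<notin> UNIV \<longrightarrow> f x = 0)}"
    by (rule finite_set_of_finite_funs) (auto intro!: finite_nth_roots)
qed

lemma finite_annihilator: "finite (annihilator (H :: 'g::{finite,ab_group_add} set))"
  by (rule finite_subset[OF _ finite_characters]) (auto simp: annihilator_def)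

lemma annihilator_mult: "\<gamma> \<in> annihilator H \<Longrightarrow> \<gamma>' \<in> annihilator H \<Longrightarrow> \<gamma> * \<gamma>' \<in> annihilator H"
  by (auto simp: annihilator_def characters_mult)

lemma annihilator_cnj: "\<gamma> \<in> annihilator H \<Longrightarrow> (\<lambda>x. cnj (\<gamma> x)) \<in> annihilator H"
  by (auto simp: annihilator_def characters_cnj)

lemma one_annihilator: "1 \<in> annihilator H"
  by (auto simp: annihilator_def characters_def)

text \<open>For \<open>x\<close> outside \<open>H\<close>, multiplication by a character that
  separates \<open>x\<close> from \<open>H\<close> permutes the annihilator, with multiplication by
  the conjugate as inverse. It scales the sum by a factor other than 1.\<close>

lemma sum_annihilator:
  fixes H :: "'g::{finite,ab_group_add} set"
  assumes "is_subgroup H"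
  shows "(\<Sum>\<gamma>\<in>annihilator H. \<gamma> x) = of_bool (x \<in> H) * of_nat (card (annihilator H))"
proof (cases "x \<in> H")
  case True
  then show ?thesis by (simp add: annihilator_def)
next
  case False
  then obtain \<gamma>0 where \<gamma>0: "\<gamma>0 \<in> annihilator H" "\<gamma>0 x \<noteq> 1" using annihilator_separates assms by metis
  then have "cnj (\<gamma>0 y) * \<gamma>0 y = 1" for y by (intro character_cnj_mult) (auto simp: annihilator_def)
  then have cancel: "cnj (\<gamma>0 y) * (\<gamma>0 y * z) = z" "\<gamma>0 y * (cnj (\<gamma>0 y) * z) = z" for y z
    by (metis mult.assoc mult_1, metis mult.assoc mult.commute mult_1)
  have "(\<Sum>\<gamma>\<in>annihilator H. \<gamma> x) = (\<Sum>\<gamma>\<in>annihilator H. (\<gamma>0 * \<gamma>) x)"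
    by (rule sum.reindex_bij_witness[of _ "\<lambda>\<gamma>. \<gamma>0 * \<gamma>" "\<lambda>\<gamma>. (\<lambda>x. cnj (\<gamma>0 x)) * \<gamma>"])
      (simp_all add: annihilator_mult annihilator_cnj \<gamma>0 fun_eq_iff cancel)
  also have "\<dots> = \<gamma>0 x * (\<Sum>\<gamma>\<in>annihilator H. \<gamma> x)" by (simp add: sum_distrib_left)
  finally show ?thesis using \<gamma>0 False by simp
qed

text \<open>Translation by \<open>h\<close> permutes \<open>H\<close> and scales the sum by a factor
  other than 1.\<close>

lemma sum_character_subgroup:
  fixes H :: "'g::{finite,ab_group_add} set"
  assumes "is_subgroup H" "\<gamma> \<in> characters" "h \<in> H" "\<gamma> h \<noteq> 1"
  shows "(\<Sum>x\<in>H. \<gamma> x) = 0"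
proof -
  have "(\<Sum>x\<in>H. \<gamma> x) = (\<Sum>x\<in>H. \<gamma> (h + x))"
    by (rule sum.reindex_bij_witness[of _ "\<lambda>x. h + x" "\<lambda>x. x - h"])
      (use assms is_subgroup_diff in \<open>auto simp: is_subgroup_def\<close>)
  also have "\<dots> = \<gamma> h * (\<Sum>x\<in>H. \<gamma> x)"
    by (simp add: character_add[OF assms(2)] sum_distrib_left)
  finally show ?thesis using assms by simp
qed

lemma char_coset_eq_iff:
  assumes "\<gamma> \<in> characters" "\<gamma>' \<in> characters"
  shows "char_coset H \<gamma> = char_coset H \<gamma>' \<longleftrightarrow> (\<forall>h\<in>H. \<gamma> h = \<gamma>' h)"
proof
  assume "char_coset H \<gamma> = char_coset H \<gamma>'"
  moreover have "\<gamma> \<in> char_coset H \<gamma>"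
    unfolding char_coset_def by (rule image_eqI[OF _ one_annihilator]) simp
  ultimately obtain \<eta> where "\<eta> \<in> annihilator H" "\<gamma> = \<gamma>' * \<eta>" by (auto simp: char_coset_def)
  then show "\<forall>h\<in>H. \<gamma> h = \<gamma>' h" by (auto simp: annihilator_def)
next
  have sub: "char_coset H \<alpha> \<subseteq> char_coset H \<beta>"
    if "\<alpha> \<in> characters" "\<beta> \<in> characters" and eq: "\<forall>h\<in>H. \<alpha> h = \<beta> h" for \<alpha> \<beta>
  proof -
    have u: "cnj (\<beta> x) * \<beta> x = 1" for x by (rule character_cnj_mult) fact
    \<comment> \<open>Conjugation inverts a character, so this is the quotient of \<alpha> by
      \<beta>, which is trivial where the two agree.\<close>
    have "(\<lambda>x. cnj (\<beta> x)) * \<alpha> \<in> annihilator H"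
      using that u by (auto simp: annihilator_def characters_mult characters_cnj)
    moreover have "\<alpha> * \<eta> = \<beta> * ((\<lambda>x. cnj (\<beta> x)) * \<alpha> * \<eta>)" for \<eta>
    proof
      fix x
      have "\<alpha> x * \<eta> x = (cnj (\<beta> x) * \<beta> x) * (\<alpha> x * \<eta> x)" by (simp only: u mult_1)
      then show "(\<alpha> * \<eta>) x = (\<beta> * ((\<lambda>x. cnj (\<beta> x)) * \<alpha> * \<eta>)) x" by (simp add: ac_simps)
    qed
    ultimately show ?thesis unfolding char_coset_def by (metis (no_types, lifting) annihilator_mult image_iff image_subsetI)
  qed
  assume "\<forall>h\<in>H. \<gamma> h = \<gamma>' h"
  then show "char_coset H \<gamma> = char_coset H \<gamma>'" using sub assms by (metis subset_antisym)
qed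

section \<open>The projections\<close>

lemma sum_fun_apply: "(\<Sum>i\<in>I. f i) x = (\<Sum>i\<in>I. f i x)"
  by (induction I rule: infinite_finite_induct) auto

lemma cinner_self_eq_0:
  fixes N :: "'g::finite set"
  assumes "cinner N x x = 0" "n \<in> N"
  shows "x n = 0"
proof -
  have "cinner N x x = of_real (\<Sum>n\<in>N. (cmod (x n))\<^sup>2)"
    unfolding cinner_def of_real_sum by (intro sum.cong refl) (simp only: complex_norm_square mult.commute)
  then have "(\<Sum>n\<in>N. (cmod (x n))\<^sup>2) = 0" using assms(1) by (metis of_real_eq_0_iff)
  then show ?thesis using assms(2) by (subst (asm) sum_nonneg_eq_0_iff) auto
qed

text \<open>The difference of two candidates lies in \<open>U\<close> and is orthogonal to itself,
  so it vanishes on \<open>N\<close>. Membership in \<open>cvec N\<close> makes it vanish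
  elsewhere.\<close>

lemma orth_proj_eqI:
  fixes N :: "'g::finite set"
  assumes U: "cfun.subspace U" "U \<subseteq> cvec N" and y: "y \<in> U"
    and orth: "\<And>u. u \<in> U \<Longrightarrow> cinner N u (x - y) = 0"
  shows "orth_proj N U x = y"
  unfolding orth_proj_def
proof (rule the_equality)
  fix z assume z: "z \<in> U \<and> (\<forall>u\<in>U. cinner N u (x - z) = 0)"
  then have zy: "z - y \<in> U" using U y by (simp add: cfun.subspace_diff)
  have "cinner N (z - y) (z - y) = cinner N (z - y) (x - y) - cinner N (z - y) (x - z)"
    by (simp add: cinner_def algebra_simps flip: sum_subtractf)
  then have "cinner N (z - y) (z - y) = 0" using z zy orth by simp
  then have "(z - y) n = 0" for n
    using cinner_self_eq_0[of N "z - y" n] zy U(2) by (cases "n \<in> N") (auto simp: cvec_def)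
  then show "z = y" by (auto simp: fun_eq_iff)
qed (use y orth in auto)

context composite_difference_set
begin

text \<open>On each block \<open>a + B\<close> of \<open>D\<close> the coset space of \<open>\<gamma>\<close> consists of the multiples of \<open>\<gamma>\<close>,
  so its orthogonal projection averages against \<open>\<gamma>\<close> over each block.\<close>

definition block_coeff :: "('g \<Rightarrow> complex) \<Rightarrow> 'g \<Rightarrow> ('g \<Rightarrow> complex) \<Rightarrow> complex" where
  "block_coeff \<gamma> a x = (\<Sum>b\<in>B. cnj (\<gamma> (a + b)) * x (a + b)) / of_nat (card B)"

text \<open>The block of \<open>d\<close> is described as the part of \<open>D\<close> in its coset
  of \<open>H\<close>. No representative in \<open>A\<close> has to be chosen, and orthogonality
  over the annihilator applies directly.\<close>

definition block_proj :: "('g \<Rightarrow> complex) \<Rightarrow> ('g \<Rightarrow> complex) \<Rightarrow> 'g \<Rightarrow> complex" where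
  "block_proj \<gamma> x d = (if d \<in> D
     then \<gamma> d * (\<Sum>d'\<in>D. of_bool (d - d' \<in> H) * (cnj (\<gamma> d') * x d')) / of_nat (card B) else 0)"

lemma same_block_iff:
  assumes "a \<in> A" "b \<in> B" "a' \<in> A" "b' \<in> B"
  shows "a + b - (a' + b') \<in> H \<longleftrightarrow> a = a'"
proof
  have bb: "b' - b \<in> H" using assms B_sub diff_in by blast
  assume "a + b - (a' + b') \<in> H"
  then have "(a + b - (a' + b')) + (b' - b) \<in> H" using bb by (rule add_in)
  then have "a - a' \<in> H" by (simp add: algebra_simps)
  then show "a = a'" using assms A_distinct_cosets by blast
next
  assume "a = a'"
  moreover have "b - b' \<in> H" using assms B_sub diff_in by blast
  ultimately show "a + b - (a' + b') \<in> H" by simp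
qed

lemma block_proj_apply:
  assumes "a \<in> A" "b \<in> B"
  shows "block_proj \<gamma> x (a + b) = \<gamma> (a + b) * block_coeff \<gamma> a x"
proof -
  have "(\<Sum>d'\<in>D. of_bool (a + b - d' \<in> H) * (cnj (\<gamma> d') * x d'))
      = (\<Sum>a'\<in>A. \<Sum>b'\<in>B. of_bool (a = a') * (cnj (\<gamma> (a' + b')) * x (a' + b')))"
    unfolding sum_over_D by (intro sum.cong refl) (simp add: same_block_iff assms)
  also have "\<dots> = (\<Sum>a'\<in>A. of_bool (a = a') * (\<Sum>b'\<in>B. cnj (\<gamma> (a' + b')) * x (a' + b')))"
    by (simp add: sum_distrib_left)
  also have "\<dots> = (\<Sum>b'\<in>B. cnj (\<gamma> (a + b')) * x (a + b'))"
    using assms by (simp add: of_bool_def if_distrib[of "\<lambda>c. c * _"] cong: if_cong)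
  finally have *: "(\<Sum>d'\<in>D. of_bool (a + b - d' \<in> H) * (cnj (\<gamma> d') * x d'))
      = (\<Sum>b'\<in>B. cnj (\<gamma> (a + b')) * x (a + b'))" .
  have "a + b \<in> D" using assms in_D_iff by blast
  then show ?thesis by (simp add: block_proj_def block_coeff_def *)
qed

text \<open>Both properties are linear in \<open>u\<close>, so it suffices to check the generators.
  These are \<gamma> times a character that is constant on the cosets of \<open>H\<close>.\<close>

lemma coset_space_memD:
  assumes \<gamma>: "\<gamma> \<in> characters" and u: "u \<in> coset_space D (char_coset H \<gamma>)"
  shows "u \<in> cvec D"
    and "d \<in> D \<Longrightarrow> d' \<in> D \<Longrightarrow> d - d' \<in> H \<Longrightarrow> cnj (\<gamma> d) * u d = cnj (\<gamma> d') * u d'"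
proof -
  let ?V = "{u \<in> cvec D. \<forall>d\<in>D. \<forall>d'\<in>D. d - d' \<in> H \<longrightarrow> cnj (\<gamma> d) * u d = cnj (\<gamma> d') * u d'}"
  have "cfun.span (phi D ` char_coset H \<gamma>) \<subseteq> ?V"
  proof (rule cfun.span_minimal)
    show "cfun.subspace ?V"
      by (auto simp: cfun.subspace_def cvec_def cscale_def ring_distribs mult.left_commute[of _ "_ :: complex"])
    show "phi D ` char_coset H \<gamma> \<subseteq> ?V"
    proof
      fix v assume "v \<in> phi D ` char_coset H \<gamma>"
      then obtain \<eta> where \<eta>: "\<eta> \<in> annihilator H" "v = phi D (\<gamma> * \<eta>)" by (auto simp: char_coset_def)
      have "\<eta> d = \<eta> d'" if "d - d' \<in> H" for d d'
        using \<eta>(1) that character_add[of \<eta> "d - d'" d'] by (simp add: annihilator_def)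
      then show "v \<in> ?V"
        using character_cnj_mult[OF \<gamma>]
        by (auto simp: \<eta>(2) cvec_def phi_def mult.left_commute[of _ "complex_of_real _"] simp flip: mult.assoc)
    qed
  qed
  then have "u \<in> ?V" using u by (auto simp: coset_space_def)
  then show "u \<in> cvec D"
    and "d \<in> D \<Longrightarrow> d' \<in> D \<Longrightarrow> d - d' \<in> H \<Longrightarrow> cnj (\<gamma> d) * u d = cnj (\<gamma> d') * u d'" by auto
qed

lemma coset_space_apply:
  assumes \<gamma>: "\<gamma> \<in> characters" and u: "u \<in> coset_space D (char_coset H \<gamma>)"
    and "a \<in> A" "b \<in> B"
  shows "u (a + b) = \<gamma> (a + b) * block_coeff \<gamma> a u"
proof -
  have "cnj (\<gamma> (a + b')) * u (a + b') = cnj (\<gamma> (a + b)) * u (a + b)" if "b' \<in> B" for b'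
    using that assms in_D_iff same_block_iff[of a b' a b] by (intro coset_space_memD(2)[OF \<gamma> u]) auto
  then have "block_coeff \<gamma> a u = (\<Sum>b'\<in>B. cnj (\<gamma> (a + b)) * u (a + b)) / of_nat (card B)"
    unfolding block_coeff_def by simp
  also have "\<dots> = cnj (\<gamma> (a + b)) * u (a + b)" using B_nonzero by simp
  finally show ?thesis using character_cnj_mult[OF \<gamma>, of "a + b"]
    by (metis mult.assoc mult.commute mult_1)
qed

text \<open>By orthogonality, averaging over the annihilator produces the indicator of the coset of
  \<open>d'\<close>. This writes \<open>block_proj\<close> as an explicit combination of the
  generators.\<close>

lemma block_proj_in: "block_proj \<gamma> x \<in> coset_space D (char_coset H \<gamma>)"
proof -
  define N where "N = card (annihilator H)"
  have "N > 0" unfolding N_def using finite_annihilator[of H] one_annihilator[of H] by (auto simp: card_gt_0_iff)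
  have D0: "sqrt (real (card D)) \<noteq> 0" using D_ne by simp
  \<comment> \<open>The square root undoes the normalization of \<open>phi\<close>, \<open>N\<close>
    that of the sum over the annihilator, and \<open>card B\<close> comes from the average over a
    block.\<close>
  define c where "c d' \<eta> = complex_of_real (sqrt (real (card D))) * (cnj (\<gamma> d') * x d' * cnj (\<eta> d'))
    / (of_nat N * of_nat (card B))" for d' \<eta>
  have "block_proj \<gamma> x = (\<Sum>d'\<in>D. \<Sum>\<eta>\<in>annihilator H. cscale (c d' \<eta>) (phi D (\<gamma> * \<eta>)))"
  proof
    fix d
    have ann: "(\<Sum>\<eta>\<in>annihilator H. cnj (\<eta> d') * \<eta> d) = of_bool (d - d' \<in> H) * of_nat N" for d'
    proof -
      have "(\<Sum>\<eta>\<in>annihilator H. cnj (\<eta> d') * \<eta> d) = (\<Sum>\<eta>\<in>annihilator H. \<eta> (d - d'))"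
      proof (rule sum.cong[OF refl])
        fix \<eta> assume "\<eta> \<in> annihilator H"
        then have "\<eta> \<in> characters" by (simp add: annihilator_def)
        then show "cnj (\<eta> d') * \<eta> d = \<eta> (d - d')"
          using character_add[of \<eta> d "- d'"] character_minus[of \<eta> d'] by simp
      qed
      then show ?thesis by (simp only: sum_annihilator[OF H_sub] N_def)
    qed
    have inner: "(\<Sum>\<eta>\<in>annihilator H. cscale (c d' \<eta>) (phi D (\<gamma> * \<eta>)) d)
        = \<gamma> d * (of_bool (d - d' \<in> H) * (cnj (\<gamma> d') * x d')) / of_nat (card B)" if "d \<in> D" for d'
    proof -
      have "(\<Sum>\<eta>\<in>annihilator H. cscale (c d' \<eta>) (phi D (\<gamma> * \<eta>)) d)
          = (\<Sum>\<eta>\<in>annihilator H. \<gamma> d * (cnj (\<gamma> d') * x d') / (of_nat N * of_nat (card B)) * (cnj (\<eta> d') * \<eta> d))"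
        using that D0 by (intro sum.cong refl) (simp add: cscale_def c_def phi_def)
      also have "\<dots> = \<gamma> d * (cnj (\<gamma> d') * x d') / (of_nat N * of_nat (card B)) * (of_bool (d - d' \<in> H) * of_nat N)"
        by (simp only: ann flip: sum_distrib_left)
      also have "\<dots> = \<gamma> d * (of_bool (d - d' \<in> H) * (cnj (\<gamma> d') * x d')) / of_nat (card B)"
        using \<open>N > 0\<close> by simp
      finally show ?thesis .
    qed
    show "block_proj \<gamma> x d = (\<Sum>d'\<in>D. \<Sum>\<eta>\<in>annihilator H. cscale (c d' \<eta>) (phi D (\<gamma> * \<eta>))) d"
    proof (cases "d \<in> D")
      case True
      then show ?thesis
        by (simp only: block_proj_def sum_fun_apply inner if_True sum_distrib_left sum_divide_distrib)
    next
      case False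
      then show ?thesis
        by (simp add: block_proj_def sum_fun_apply) (simp add: cscale_def phi_def)
    qed
  qed
  moreover have "(\<Sum>d'\<in>D. \<Sum>\<eta>\<in>annihilator H. cscale (c d' \<eta>) (phi D (\<gamma> * \<eta>))) \<in> cfun.span (phi D ` char_coset H \<gamma>)"
    unfolding char_coset_def by (intro cfun.span_sum cfun.span_scale cfun.span_base imageI)
  ultimately show ?thesis by (simp add: coset_space_def)
qed

text \<open>Orthogonality of the remainder is checked on one block at a time. There every
  \<open>u\<close> in the space is a multiple of \<gamma>, and \<open>block_coeff\<close> is the
  average that makes the sum against \<gamma> vanish.\<close>

lemma coset_proj_eq:
  assumes \<gamma>: "\<gamma> \<in> characters"
  shows "coset_proj D (char_coset H \<gamma>) x = block_proj \<gamma> x"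
  unfolding coset_proj_def
proof (rule orth_proj_eqI)
  show "cfun.subspace (coset_space D (char_coset H \<gamma>))"
    by (simp add: coset_space_def cfun.subspace_span)
  show "coset_space D (char_coset H \<gamma>) \<subseteq> cvec D" using coset_space_memD(1)[OF \<gamma>] by blast
  show "block_proj \<gamma> x \<in> coset_space D (char_coset H \<gamma>)" by (rule block_proj_in)
  fix u assume u: "u \<in> coset_space D (char_coset H \<gamma>)"
  have "(\<Sum>b\<in>B. cnj (u (a + b)) * (x (a + b) - block_proj \<gamma> x (a + b))) = 0" if "a \<in> A" for a
  proof -
    have "(\<Sum>b\<in>B. cnj (u (a + b)) * (x (a + b) - block_proj \<gamma> x (a + b)))
        = (\<Sum>b\<in>B. cnj (block_coeff \<gamma> a u) * (cnj (\<gamma> (a + b)) * x (a + b) - block_coeff \<gamma> a x))"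
    proof (rule sum.cong[OF refl])
      fix b assume b: "b \<in> B"
      have "cnj (\<gamma> (a + b)) * \<gamma> (a + b) = 1" by (rule character_cnj_mult[OF \<gamma>])
      then show "cnj (u (a + b)) * (x (a + b) - block_proj \<gamma> x (a + b))
        = cnj (block_coeff \<gamma> a u) * (cnj (\<gamma> (a + b)) * x (a + b) - block_coeff \<gamma> a x)"
        unfolding coset_space_apply[OF \<gamma> u that b] block_proj_apply[OF that b] complex_cnj_mult
        by algebra
    qed
    also have "\<dots> = cnj (block_coeff \<gamma> a u) * ((\<Sum>b\<in>B. cnj (\<gamma> (a + b)) * x (a + b)) - of_nat (card B) * block_coeff \<gamma> a x)"
      by (simp add: sum_subtractf flip: sum_distrib_left)
    also have "\<dots> = 0" using B_nonzero by (simp add: block_coeff_def)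
    finally show ?thesis .
  qed
  then show "cinner D u (x - block_proj \<gamma> x) = 0"
    by (simp add: cinner_def sum_over_D)
qed

section \<open>Inner products of the vectors \<open>zeta\<close> and products of projections\<close>

lemma zeta_inner:
  "cinner B (zeta D B \<gamma>1) (zeta D B \<gamma>2) = (\<Sum>b\<in>B. cnj (\<gamma>1 b) * \<gamma>2 b) / of_nat (card B)"
proof -
  let ?c = "sqrt (real S) / sqrt (real (card D))"
  \<comment> \<open>As \<open>card D = S * card B\<close>, the squared factor is the reciprocal of
    \<open>card B\<close>, and the inner product becomes an average over \<open>B\<close>.\<close>
  have "?c * ?c = real S / real (card D)" by simp
  also have "\<dots> = 1 / real (card B)" using S_nonzero by (simp add: card_D)
  finally have c: "complex_of_real ?c * complex_of_real ?c = 1 / of_nat (card B)"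
    by (metis of_real_1 of_real_divide of_real_mult of_real_of_nat_eq)
  have "cinner B (zeta D B \<gamma>1) (zeta D B \<gamma>2)
      = (\<Sum>b\<in>B. (complex_of_real ?c * complex_of_real ?c) * (cnj (\<gamma>1 b) * \<gamma>2 b))"
    unfolding cinner_def by (intro sum.cong refl) (simp add: zeta_def fine_S_eq del: of_real_divide)
  then show ?thesis by (simp only: c flip: sum_distrib_left) simp
qed

text \<open>A character splits on \<open>a + B\<close> into its value at \<open>a\<close> and its
  values on \<open>B\<close>. The overlap of two characters on a block is therefore the same for all
  blocks up to a phase.\<close>

lemma block_coeff_proj:
  assumes "\<gamma>1 \<in> characters" "\<gamma>2 \<in> characters" "a \<in> A"
  shows "block_coeff \<gamma>1 a (block_proj \<gamma>2 x)
    = cnj (\<gamma>1 a) * \<gamma>2 a * cinner B (zeta D B \<gamma>1) (zeta D B \<gamma>2) * block_coeff \<gamma>2 a x"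
proof -
  have "(\<Sum>b\<in>B. cnj (\<gamma>1 (a + b)) * block_proj \<gamma>2 x (a + b))
      = (\<Sum>b\<in>B. (cnj (\<gamma>1 a) * \<gamma>2 a * block_coeff \<gamma>2 a x) * (cnj (\<gamma>1 b) * \<gamma>2 b))"
    using assms by (intro sum.cong refl) (simp add: block_proj_apply character_add)
  then show ?thesis unfolding zeta_inner block_coeff_def[of \<gamma>1]
    by (simp flip: sum_distrib_left)
qed

text \<open>On the block of \<open>a\<close> every inner projection contributes one
  \<open>zeta\<close> inner product and a phase. The two phases of \<gamma>2 cancel, so both sides
  carry the same three inner products and the same remaining phase.\<close>

lemma triple_product:
  assumes "\<gamma>1 \<in> characters" "\<gamma>2 \<in> characters" "\<gamma>3 \<in> characters"
  shows "cscale (cinner B (zeta D B \<gamma>1) (zeta D B \<gamma>3))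
      (coset_proj D (char_coset H \<gamma>1) (coset_proj D (char_coset H \<gamma>2) (coset_proj D (char_coset H \<gamma>3) x)))
    = cscale (cinner B (zeta D B \<gamma>1) (zeta D B \<gamma>2) * cinner B (zeta D B \<gamma>2) (zeta D B \<gamma>3))
      (coset_proj D (char_coset H \<gamma>1) (coset_proj D (char_coset H \<gamma>3) x))"
proof
  fix d
  show "cscale (cinner B (zeta D B \<gamma>1) (zeta D B \<gamma>3))
      (coset_proj D (char_coset H \<gamma>1) (coset_proj D (char_coset H \<gamma>2) (coset_proj D (char_coset H \<gamma>3) x))) d
    = cscale (cinner B (zeta D B \<gamma>1) (zeta D B \<gamma>2) * cinner B (zeta D B \<gamma>2) (zeta D B \<gamma>3))
      (coset_proj D (char_coset H \<gamma>1) (coset_proj D (char_coset H \<gamma>3) x)) d"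
  proof (cases "d \<in> D")
    case True
    then obtain a b where ab: "a \<in> A" "b \<in> B" "d = a + b" using in_D_iff by blast
    have "cnj (\<gamma>2 a) * \<gamma>2 a = 1" by (rule character_cnj_mult) fact
    then show ?thesis
      unfolding coset_proj_eq[OF assms(1)] coset_proj_eq[OF assms(2)] coset_proj_eq[OF assms(3)]
        cscale_def ab(3) block_proj_apply[OF ab(1,2)]
        block_coeff_proj[OF assms(1,2) ab(1)] block_coeff_proj[OF assms(1,3) ab(1)]
        block_coeff_proj[OF assms(2,3) ab(1)]
      by algebra
  next
    case False
    then show ?thesis by (simp add: cscale_def coset_proj_eq assms block_proj_def)
  qed
qed

lemma zeta_inner_same_coset:
  assumes "\<gamma> \<in> characters" "\<gamma>' \<in> characters" "char_coset H \<gamma> = char_coset H \<gamma>'"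
  shows "cinner B (zeta D B \<gamma>) (zeta D B \<gamma>') = 1"
proof -
  have "cnj (\<gamma> b) * \<gamma>' b = 1" if "b \<in> B" for b
    using that assms char_coset_eq_iff[of \<gamma> \<gamma>' H] B_sub character_cnj_mult[of \<gamma>' b] by auto
  then show ?thesis using B_nonzero by (simp add: zeta_inner)
qed

text \<open>The quotient \<beta> of the two characters is nontrivial on \<open>H\<close>. Expanding
  the squared modulus of its sum over \<open>B\<close> by differences leaves
  \<open>card B - l\<close>, because \<beta> sums to 0 over \<open>H\<close>; \<open>index_B\<close>
  expresses this number through \<open>S\<close>.\<close>

lemma zeta_inner_different_coset:
  assumes "\<gamma> \<in> characters" "\<gamma>' \<in> characters" "char_coset H \<gamma> \<noteq> char_coset H \<gamma>'"
  shows "cmod (cinner B (zeta D B \<gamma>) (zeta D B \<gamma>')) = 1 / sqrt (real S)"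
proof -
  define \<beta> where "\<beta> = (\<lambda>x. cnj (\<gamma> x)) * \<gamma>'"
  have \<beta>: "\<beta> \<in> characters" unfolding \<beta>_def by (intro characters_mult characters_cnj assms)
  obtain h where h: "h \<in> H" "\<gamma> h \<noteq> \<gamma>' h" using char_coset_eq_iff[of \<gamma> \<gamma>' H] assms by blast
  have "\<beta> h \<noteq> 1"
  proof
    assume "\<beta> h = 1"
    then have "cnj (\<gamma> h) * \<gamma>' h = cnj (\<gamma> h) * \<gamma> h"
      using character_cnj_mult[OF assms(1), of h] by (simp add: \<beta>_def)
    moreover have "\<gamma> h \<noteq> 0" using character_norm[OF assms(1), of h] by auto
    ultimately show False using h by simp
  qed
  \<comment> \<open>The formula for \<open>card B - l\<close> in \<open>index_B\<close> is available
    only for nontrivial \<open>H\<close>.\<close>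
  have "card H \<noteq> 1"
  proof
    assume "card H = 1"
    then have "H = {0}" using zero_in by (auto simp: card_1_singleton_iff)
    then show False using h \<open>\<beta> h \<noteq> 1\<close> character_0[OF \<beta>] by simp
  qed
  then obtain l where l: "\<And>g. g \<in> H - {0} \<Longrightarrow> diff_count B g = l"
    and lS: "(real (card B) - real l) * real S = (real (card B))\<^sup>2"
    using index_B by metis
  let ?z = "\<Sum>b\<in>B. \<beta> b"
  have "of_real ((cmod ?z)\<^sup>2) = ?z * cnj ?z" by (rule complex_norm_square)
  also have "\<dots> = (\<Sum>b\<in>B. \<Sum>b'\<in>B. \<beta> (b - b'))"
    using character_add[OF \<beta>, of _ "- _"] character_minus[OF \<beta>] by (simp add: sum_product)
  also have "\<dots> = (\<Sum>g\<in>UNIV. of_nat (diff_count B g) * \<beta> g)" by (rule sum_diff_count[symmetric])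
  also have "\<dots> = (\<Sum>g\<in>H. of_nat (diff_count B g) * \<beta> g)"
    by (rule sum.mono_neutral_right) (auto simp: diff_count_outside[OF H_sub B_sub])
  also have "\<dots> = of_nat (card B) + of_nat l * (\<Sum>g\<in>H - {0}. \<beta> g)"
    using zero_in l by (simp add: sum.remove[of H 0] diff_count_0 character_0[OF \<beta>] sum_distrib_left)
  also have "(\<Sum>g\<in>H - {0}. \<beta> g) = - 1"
    using sum_character_subgroup[OF H_sub \<beta> h(1) \<open>\<beta> h \<noteq> 1\<close>] zero_in character_0[OF \<beta>]
    by (simp add: sum.remove[of H 0] add_eq_0_iff)
  finally have "complex_of_real ((cmod ?z)\<^sup>2) = of_real (real (card B) - real l)" by simp
  then have z: "(cmod ?z)\<^sup>2 = real (card B) - real l" by (simp only: of_real_eq_iff)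
  have "cinner B (zeta D B \<gamma>) (zeta D B \<gamma>') = ?z / of_nat (card B)"
    by (simp add: zeta_inner \<beta>_def)
  then have "(cmod (cinner B (zeta D B \<gamma>) (zeta D B \<gamma>')))\<^sup>2 = (real (card B) - real l) / (real (card B))\<^sup>2"
    by (simp add: norm_divide power_divide z)
  also have "\<dots> = (1 / sqrt (real S))\<^sup>2"
    using lS S_nonzero B_nonzero by (simp add: power_divide field_simps)
  finally show ?thesis by (rule power2_eq_imp_eq) auto
qed

end

theorem theorem4p2:
  fixes D H A B :: "'g::{finite,ab_group_add} set"
  assumes "difference_set UNIV D" and "D \<noteq> {}" and "composite D"
    and "composite_via H A B D"
  shows
    "(real (card B) = real (card D) / fine_S D
      \<and> relative_difference_set H A (fine_S D + 1) (real (card H)) (fine_S D)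
           ((fine_S D - 1) / real (card H))
      \<and> A \<inter> H = {}
      \<and> (int CARD('g) - int (card D)) dvd (int (card D) - 1))
    \<and> (amalgam D \<and> amalgam_via H D \<and> (\<forall>a\<in>A. slice H D a = B))
    \<and> ((\<forall>\<gamma>1\<in>characters. \<forall>\<gamma>2\<in>characters. \<forall>\<gamma>3\<in>characters. \<forall>x\<in>cvec D.
          cscale (cinner B (zeta D B \<gamma>1) (zeta D B \<gamma>3))
            (coset_proj D (char_coset H \<gamma>1)
              (coset_proj D (char_coset H \<gamma>2) (coset_proj D (char_coset H \<gamma>3) x)))
          = cscale (cinner B (zeta D B \<gamma>1) (zeta D B \<gamma>2) * cinner B (zeta D B \<gamma>2) (zeta D B \<gamma>3))
              (coset_proj D (char_coset H \<gamma>1) (coset_proj D (char_coset H \<gamma>3) x)))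
      \<and> (\<forall>\<gamma>\<in>characters. \<forall>\<gamma>'\<in>characters.
          (char_coset H \<gamma> = char_coset H \<gamma>' \<longrightarrow> cmod (cinner B (zeta D B \<gamma>) (zeta D B \<gamma>')) = 1)
          \<and> (char_coset H \<gamma> \<noteq> char_coset H \<gamma>' \<longrightarrow>
               cmod (cinner B (zeta D B \<gamma>) (zeta D B \<gamma>')) = 1 / sqrt (fine_S D))))"
proof -
  interpret composite_difference_set H A B D by unfold_locales fact
  have "real (card B) = real (card D) / fine_S D"
    using S_nonzero by (simp add: card_D fine_S_eq)
  moreover have "amalgam D" using amalgam_via by (auto simp: amalgam_def)
  ultimately show ?thesis
    unfolding fine_S_eq
    by (intro conjI ballI impI rds A_disj complement_dvd amalgam_via slice_A triple_product
        zeta_inner_different_coset) (simp_all add: zeta_inner_same_coset)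
qed

end
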